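(* Let $G$ be an abelian group. Then the following assertions are equivalent: (i) every metrizable locally quasi-convex group topology on $G$ is Mackey; (ii) $G$ is bounded.
   Context: $\mathbb{T}$ is the unit circle group in $\mathbb{C}$ and $\mathbb{T}_+=\{z\in\mathbb{T}:\mathrm{Re}(z)\ge 0\}$. An abelian group $G$ is bounded if there is a positive integer $m$ with $mG=\{0\}$. For a topological abelian group $(G,\tau)$, the dual group $(G,\tau)^\wedge$ is the group of all continuous homomorphisms (characters) $(G,\tau)\to\mathbb{T}$. A subset $M\subseteq G$ is quasi-convex if for every $x\in G\setminus M$ there is $\phi\in (G,\tau)^\wedge$ with $\phi(M)\subseteq\mathbb{T}_+$ and $\phi(x)\notin\mathbb{T}_+$. The topology $\tau$ is locally quasi-convex if it has a basis of neighborhoods of $0$ consisting of quasi-convex sets; locally quasi-convex group topologies are taken to be Hausdorff. Two group topologies $\tau,\nu$ on $G$ are compatible if $(G,\tau)^\wedge=(G,\nu)^\wedge$ (as subgroups of $\mathrm{Hom}(G,\mathbb{T})$). A locally quasi-convex group topology $\tau$ on $G$ is Mackey if $\nu\le\tau$ (that is, $\nu\subseteq\tau$) for every locally quasi-convex group topology $\nu$ on $G$ compatible with $\tau$. *)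

theory Defs
  imports "HOL-Analysis.Analysis"
begin

text \<open>The abelian group is an arbitrary type of class \<^class>\<open>ab_group_add\<close>. Since several group
  topologies on the same group are compared, a topology is a value of type \<^typ>\<open>'a topology\<close>
  rather than a type-class instance.\<close>

definition group_topology :: "'a::ab_group_add topology \<Rightarrow> bool" where
  "group_topology T \<longleftrightarrow>
     topspace T = UNIV \<and>
     continuous_map (prod_topology T T) T (\<lambda>(x, y). x + y) \<and>
     continuous_map T T uminus"

definition circle :: "complex set" where
  "circle = {z. cmod z = 1}"

definition circle_plus :: "complex set" where
  "circle_plus = {z \<in> circle. Re z \<ge> 0}"

definition dual_group :: "'a::ab_group_add topology \<Rightarrow> ('a \<Rightarrow> complex) set" where
  "dual_group T =
     {\<phi>. continuous_map T (top_of_set circle) \<phi> \<and> (\<forall>x y. \<phi> (x + y) = \<phi> x * \<phi> y)}"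

definition quasi_convex :: "'a::ab_group_add topology \<Rightarrow> 'a set \<Rightarrow> bool" where
  "quasi_convex T M \<longleftrightarrow>
     (\<forall>x. x \<notin> M \<longrightarrow> (\<exists>\<phi>\<in>dual_group T. \<phi> ` M \<subseteq> circle_plus \<and> \<phi> x \<notin> circle_plus))"

text \<open>Neighbourhoods of \<open>0\<close> need not be open; they only contain an open set around \<open>0\<close>.\<close>

definition locally_quasi_convex :: "'a::ab_group_add topology \<Rightarrow> bool" where
  "locally_quasi_convex T \<longleftrightarrow>
     group_topology T \<and> Hausdorff_space T \<and>
     (\<forall>U. openin T U \<and> 0 \<in> U \<longrightarrow>
        (\<exists>M V. quasi_convex T M \<and> openin T V \<and> 0 \<in> V \<and> V \<subseteq> M \<and> M \<subseteq> U))"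

definition compatible :: "'a::ab_group_add topology \<Rightarrow> 'a topology \<Rightarrow> bool" where
  "compatible T N \<longleftrightarrow> dual_group T = dual_group N"

definition mackey :: "'a::ab_group_add topology \<Rightarrow> bool" where
  "mackey T \<longleftrightarrow>
     locally_quasi_convex T \<and>
     (\<forall>N. locally_quasi_convex N \<and> compatible N T \<longrightarrow> (\<forall>U. openin N U \<longrightarrow> openin T U))"

text \<open>The class \<^class>\<open>ab_group_add\<close> has no multiplication by natural numbers, so the multiple
  \<open>m x\<close> is written as an \<open>m\<close>-fold sum.\<close>

definition bounded_group :: "'a::ab_group_add itself \<Rightarrow> bool" where
  "bounded_group _ \<longleftrightarrow> (\<exists>m::nat. m > 0 \<and> range (\<lambda>x::'a. \<Sum>i<m. x) = {0})"

end

theory Submission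
  imports Defs
begin

text \<open>
  In a group of exponent \<open>m\<close> a locally quasi-convex topology has a base of open subgroups, because a
  root of unity all of whose powers lie in the right half plane is \<open>1\<close>. If an open subgroup \<open>H\<close> of a
  compatible topology were not open in the metrizable one, there would be a null sequence outside
  \<open>H\<close>, and a gliding hump argument gives a character that is trivial on \<open>H\<close> but not on infinitely many
  members of the sequence, hence continuous for only one of the topologies.

  An unbounded group contains an infinite cyclic group, a quasicyclic group, or an infinite direct sum of
  cyclic groups of unbounded orders. On such a subgroup \<open>H\<close> there are characters \<open>\<phi> n\<close> such that
  uniform convergence of all \<open>\<phi> n\<close> is strictly finer than pointwise convergence, which is metrizable,
  but admits no further continuous character. Both topologies extend to the whole group with \<open>H\<close> open.
\<close>

section \<open>Characters and their extension\<close>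

text \<open>The obstacle in the unbounded case is that the uniform topology, although strictly
  finer, must gain no character. Hence the scales \<open>q k\<close> of the generators
  \<open>e k\<close> tend to infinity while the sums of \<open>q k * |b n k|\<close> stay bounded in
  \<open>n\<close>: a fixed small fraction of \<open>q k\<close> copies of every \<open>e k\<close>
  together remains uniformly small, so a continuous \<open>\<psi>\<close> has
  \<open>q k * Arg (\<psi> (e k))\<close> tending to 0. In each of the three kinds of subgroup this
  arithmetic condition leaves only finite products of powers of the \<open>\<phi> n\<close>.

  The three cases need no structure theorem. In a torsion group, suppose first that for all
  \<open>m > 0\<close> and finite subgroups \<open>F\<close> some nonzero element of
  \<open>m G\<close> generates a subgroup meeting \<open>F\<close> only in 0; then independent
  elements of growing order can be picked one by one. Otherwise some finite \<open>F\<close> meets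
  every nonzero cyclic subgroup of some \<open>m G\<close> nontrivially; then the finite traces of
  the groups \<open>m n! G\<close> on \<open>F\<close> stabilize, and a stable \<open>m n! G\<close>
  is divisible.\<close>

definition zmul :: "int \<Rightarrow> 'a::ab_group_add \<Rightarrow> 'a" where
  "zmul k x = (\<Sum>i<nat k. x) - (\<Sum>i<nat (- k). x)"

lemma zmul_0_left [simp]: "zmul 0 x = 0"
  by (simp add: zmul_def)

lemma zmul_add1: "zmul (k + 1) x = zmul k x + x"
proof (cases "k \<ge> 0")
  case True
  then have "nat (k + 1) = Suc (nat k)" "nat (- k) = 0" "nat (- (k + 1)) = 0" by auto
  then show ?thesis by (simp only: zmul_def) simp
next
  case False
  then have "nat (- k) = Suc (nat (- (k + 1)))" "nat k = 0" "nat (k + 1) = 0" by auto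
  then show ?thesis by (simp only: zmul_def) simp
qed

lemma zmul_1 [simp]: "zmul 1 x = x"
  using zmul_add1 [of 0 x] by simp

lemma zmul_diff1: "zmul (k - 1) x = zmul k x - x"
  using zmul_add1 [of "k - 1" x] by simp

lemma zmul_add_left: "zmul (k + l) x = zmul k x + zmul l x"
proof (induction l rule: int_induct [where k = 0])
  case (step1 i)
  then show ?case by (simp add: zmul_add1 flip: add.assoc)
next
  case (step2 i)
  then show ?case
    using zmul_diff1 [of "k + i" x] by (simp add: zmul_diff1 add_diff_eq)
qed simp

lemma zmul_diff_left: "zmul (k - l) x = zmul k x - zmul l x"
  using zmul_add_left [of "k - l" l x] by simp

lemma zmul_add_right: "zmul k (x + y) = zmul k x + zmul k y"
  by (induction k rule: int_induct [where k = 0])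
     (simp_all add: zmul_add1 zmul_diff1 algebra_simps)

text \<open>Regarding the group as a module over the integers makes linear algebra available:
  \<open>zm.subspace\<close> means subgroup, and \<open>zm.span\<close> the subgroup generated by a
  set.\<close>

interpretation zm: module "zmul :: int \<Rightarrow> 'a::ab_group_add \<Rightarrow> 'a"
proof
  show "zmul a (zmul b x) = zmul (a * b) x" for a b and x :: 'a
  proof (induction a rule: int_induct [where k = 0])
    case (step1 i)
    then show ?case by (simp add: zmul_add1 zmul_add_left distrib_right)
  next
    case (step2 i)
    then show ?case by (simp add: zmul_diff1 zmul_diff_left left_diff_distrib)
  qed simp
qed (simp_all add: zmul_add_left zmul_add_right)

lemma zmul_of_nat: "zmul (int n) x = (\<Sum>i<n. x)"
  by (simp add: zmul_def)

text \<open>No topology enters: these are all of Hom(G, T). For a group topology, the continuous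
  ones form \<open>dual_group\<close>.\<close>

definition character :: "('a::ab_group_add \<Rightarrow> complex) \<Rightarrow> bool" where
  "character \<phi> \<longleftrightarrow> (\<forall>x. cmod (\<phi> x) = 1) \<and> (\<forall>x y. \<phi> (x + y) = \<phi> x * \<phi> y)"

lemma character_norm [simp]: "character \<phi> \<Longrightarrow> cmod (\<phi> x) = 1"
  by (simp add: character_def)

lemma character_nz [simp]: "character \<phi> \<Longrightarrow> \<phi> x \<noteq> 0"
  using character_norm [of \<phi> x] by force

lemma character_add: "character \<phi> \<Longrightarrow> \<phi> (x + y) = \<phi> x * \<phi> y"
  by (simp add: character_def)

lemma character_0 [simp]: "character \<phi> \<Longrightarrow> \<phi> 0 = 1"
  using character_add [of \<phi> 0 0] by simp

lemma character_diff: "character \<phi> \<Longrightarrow> \<phi> (x - y) = \<phi> x / \<phi> y"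
  using character_add [of \<phi> "x - y" y] by simp

lemma character_minus: "character \<phi> \<Longrightarrow> \<phi> (- x) = inverse (\<phi> x)"
  using character_diff [of \<phi> 0 x] by (simp add: divide_inverse)

lemma character_zmul: "character \<phi> \<Longrightarrow> \<phi> (zmul k x) = \<phi> x powi k"
  by (induction k rule: int_induct [where k = 0])
     (simp_all add: zmul_add1 zmul_diff1 character_add character_diff power_int_add power_int_diff)

lemma character_mult: "character \<phi> \<Longrightarrow> character \<psi> \<Longrightarrow> character (\<lambda>x. \<phi> x * \<psi> x)"
  by (simp add: character_def norm_mult)

lemma character_powi: "character \<phi> \<Longrightarrow> character (\<lambda>x. \<phi> x powi k)"
  by (simp add: character_def norm_power_int power_int_mult_distrib)

text \<open>A partial character is represented by its graph, a subgroup of the product with the circle.\<close>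

definition partial_character :: "('a::ab_group_add \<times> complex) set \<Rightarrow> bool" where
  "partial_character R \<longleftrightarrow> (0, 1) \<in> R \<and> (\<forall>x a. (x, a) \<in> R \<longrightarrow> cmod a = 1) \<and>
     (\<forall>x a y b. (x, a) \<in> R \<longrightarrow> (y, b) \<in> R \<longrightarrow> (x - y, a / b) \<in> R) \<and>
     (\<forall>a. (0, a) \<in> R \<longrightarrow> a = 1)"

lemma partial_characterD:
  assumes "partial_character R"
  shows "(0, 1) \<in> R" "(x, a) \<in> R \<Longrightarrow> cmod a = 1"
    "(x, a) \<in> R \<Longrightarrow> (y, b) \<in> R \<Longrightarrow> (x - y, a / b) \<in> R"
    "(0, a) \<in> R \<Longrightarrow> a = 1"
  using assms unfolding partial_character_def by blast+

lemma partial_character_add: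
  assumes "partial_character R" "(x, a) \<in> R" "(y, b) \<in> R"
  shows "(x + y, a * b) \<in> R"
proof -
  have "(0 - y, 1 / b) \<in> R"
    by (intro partial_characterD(3) [OF assms(1)] partial_characterD(1) [OF assms(1)] assms)
  from partial_characterD(3) [OF assms(1,2) this] show ?thesis by simp
qed

lemma partial_character_zmul:
  assumes R: "partial_character R" and x: "(x, a) \<in> R"
  shows "(zmul k x, a powi k) \<in> R"
proof -
  have [simp]: "a \<noteq> 0" using partial_characterD(2) [OF R x] by auto
  show ?thesis
    by (induction k rule: int_induct [where k = 0])
       (simp_all add: zmul_add1 zmul_diff1 power_int_add power_int_diff
         partial_characterD(1,3) [OF R] partial_character_add [OF R] x)
qed

lemma partial_character_unique:
  assumes "partial_character R" "(x, a) \<in> R" "(x, b) \<in> R"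
  shows "a = b"
proof -
  have "(0, a / b) \<in> R" using partial_characterD(3) [OF assms] by simp
  then have "a / b = 1" by (rule partial_characterD(4) [OF assms(1)])
  then show ?thesis by (simp add: divide_eq_1_iff)
qed

text \<open>The subgroup generated by \<open>R\<close> and \<open>(x, c)\<close> is again a graph
  unless it contains some \<open>(0, a)\<close> with \<open>a \<noteq> 1\<close>. Such a pair can
  only come from a multiple of \<open>x\<close> in the domain of \<open>R\<close>, and
  \<open>rel\<close> makes \<open>c\<close> agree there.\<close>

lemma partial_character_insert:
  assumes R: "partial_character R" and c: "cmod c = 1"
    and rel: "\<And>k a. (zmul k x, a) \<in> R \<Longrightarrow> c powi k = a"
  shows "\<exists>R'. partial_character R' \<and> R \<subseteq> R' \<and> (x, c) \<in> R'"
proof -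
  define R' where "R' = {(y + zmul k x, b * c powi k) | y b k. (y, b) \<in> R}"
  have nz [simp]: "c \<noteq> 0" using c by auto
  have I: "(y + zmul k x, b * c powi k) \<in> R'" if "(y, b) \<in> R" for y b k
    unfolding R'_def using that by blast
  have "partial_character R'"
    unfolding partial_character_def
  proof (intro conjI allI impI)
    show "(0, 1) \<in> R'" using I [of 0 1 0] partial_characterD(1) [OF R] by simp
    show "cmod a = 1" if "(z, a) \<in> R'" for z a
      using that partial_characterD(2) [OF R]
      by (auto simp: R'_def norm_mult norm_power_int c)
    show "(u - v, a / b) \<in> R'" if uv: "(u, a) \<in> R'" "(v, b) \<in> R'" for u a v b
    proof -
      obtain y b1 k z b2 l where 1: "(y, b1) \<in> R" "(z, b2) \<in> R" "u = y + zmul k x"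
        "a = b1 * c powi k" "v = z + zmul l x" "b = b2 * c powi l"
        using uv unfolding R'_def by blast
      show ?thesis
        using I [OF partial_characterD(3) [OF R 1(1,2)], of "k - l"]
        by (simp add: 1 zm.scale_left_diff_distrib power_int_diff algebra_simps)
    qed
    show "a = 1" if a: "(0, a) \<in> R'" for a
    proof -
      obtain y b k where 1: "(y, b) \<in> R" "0 = y + zmul k x" "a = b * c powi k"
        using a unfolding R'_def by blast
      have "(0 - y, 1 / b) \<in> R" by (intro partial_characterD(3) [OF R] partial_characterD(1) [OF R] 1)
      moreover have "0 - y = zmul k x" using 1(2) by (metis add_diff_cancel_left')
      ultimately have "c powi k = 1 / b" using rel by metis
      moreover have "b \<noteq> 0" using partial_characterD(2) [OF R 1(1)] by auto
      ultimately show ?thesis using 1(3) by simp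
    qed
  qed
  moreover have "R \<subseteq> R'" using I [where k = 0] by auto
  moreover have "(x, c) \<in> R'" using I [of 0 1 1] partial_characterD(1) [OF R] by simp
  ultimately show ?thesis by blast
qed

lemma unit_root_exists:
  assumes "cmod a = 1" "n > 0"
  shows "\<exists>c. cmod c = 1 \<and> c ^ n = a"
proof -
  have "cis (Arg a / n) ^ n = a"
    using assms cis_Arg [of a] by (cases "a = 0") (simp_all add: Complex.DeMoivre sgn_div_norm)
  then show ?thesis by (intro exI [of _ "cis (Arg a / n)"]) simp
qed

text \<open>The \<open>k\<close> with \<open>zmul k x \<in> S\<close> form an ideal of the integers
  with positive generator \<open>n\<close>, by division with remainder. A general \<open>S\<close>
  serves the extension step as well as, with \<open>S = {0}\<close>, the order of an
  element.\<close>

lemma least_multiple_dvd: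
  assumes S: "zm.subspace S" and n: "n = (LEAST n::nat. n > 0 \<and> zmul (int n) x \<in> S)"
    and ex: "k \<noteq> 0" "zmul k x \<in> S"
  shows "n > 0" "zmul (int n) x \<in> S" "zmul l x \<in> S \<Longrightarrow> int n dvd l"
proof -
  have "nat \<bar>k\<bar> > 0 \<and> zmul (int (nat \<bar>k\<bar>)) x \<in> S"
    using ex zm.subspace_neg [OF S] by (auto simp: abs_if)
  from LeastI [where P = "\<lambda>n::nat. n > 0 \<and> zmul (int n) x \<in> S", OF this]
  show n0: "n > 0" and nS: "zmul (int n) x \<in> S" unfolding n by auto
  show "int n dvd l" if l: "zmul l x \<in> S"
  proof (rule ccontr)
    assume nd: "\<not> int n dvd l"
    define r where "r = nat (l mod int n)"
    have "l mod int n \<ge> 0" "l mod int n < int n" "l mod int n \<noteq> 0"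
      using n0 nd by (simp_all add: dvd_eq_mod_eq_0)
    then have r: "0 < r" "r < n" "int r = l mod int n"
      unfolding r_def by linarith+
    have "zmul l x - zmul (l div int n) (zmul (int n) x) \<in> S"
      by (intro zm.subspace_diff zm.subspace_scale S l nS)
    moreover have "zmul l x - zmul (l div int n) (zmul (int n) x) = zmul (int r) x"
      by (simp add: r flip: zm.scale_left_diff_distrib minus_div_mult_eq_mod)
    ultimately show False
      using r not_less_Least [of r "\<lambda>n::nat. n > 0 \<and> zmul (int n) x \<in> S"] unfolding n by auto
  qed
qed

lemma subspace_Domain: "partial_character R \<Longrightarrow> zm.subspace (Domain R)"
  by (auto simp: zm.subspace_def intro: partial_characterD partial_character_add
      partial_character_zmul)

text \<open>The circle is divisible. If nonzero multiples of \<open>x\<close> have prescribed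
  values, the least one \<open>n\<close> governs all relations and an \<open>n\<close>-th root of
  its value works; otherwise the value at \<open>x\<close> is free and 1 is taken.\<close>

lemma partial_character_insert_exists:
  assumes R: "partial_character R"
  shows "\<exists>R'. partial_character R' \<and> R \<subseteq> R' \<and> x \<in> Domain R'"
proof (cases "\<exists>k. k \<noteq> 0 \<and> zmul k x \<in> Domain R")
  case False
  have "1 powi k = a" if "(zmul k x, a) \<in> R" for k a
  proof -
    have "k = 0" using False that by blast
    then show ?thesis using partial_characterD(4) [OF R] that by auto
  qed
  then show ?thesis using partial_character_insert [OF R, of 1 x] by auto
next
  case True
  then obtain k where k: "k \<noteq> 0" "zmul k x \<in> Domain R" by blast
  define n where "n = (LEAST n::nat. n > 0 \<and> zmul (int n) x \<in> Domain R)"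
  note n = least_multiple_dvd [OF subspace_Domain [OF R] n_def k]
  obtain a where a: "(zmul (int n) x, a) \<in> R" using n(2) by blast
  obtain c where c: "cmod c = 1" "c ^ n = a"
    using unit_root_exists [OF partial_characterD(2) [OF R a] n(1)] by blast
  have "c powi l = b" if l: "(zmul l x, b) \<in> R" for l b
  proof -
    have "int n dvd l" using n(3) l by blast
    then obtain j where j: "l = int n * j" by (elim dvdE)
    have "(zmul l x, a powi j) \<in> R"
      using partial_character_zmul [OF R a, of j] by (simp add: j mult.commute)
    then have "b = a powi j" using partial_character_unique [OF R l] by blast
    then show ?thesis by (simp add: j power_int_mult c(2))
  qed
  then show ?thesis using partial_character_insert [OF R c(1), of x] by blast
qed

lemma partial_character_Union:
  assumes "C \<noteq> {}" "subset.chain (Collect partial_character) C"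
  shows "partial_character (\<Union>C)"
proof -
  have C: "partial_character R" if "R \<in> C" for R
    using assms that by (auto simp: subset_chain_def)
  have ch: "R \<subseteq> R' \<or> R' \<subseteq> R" if "R \<in> C" "R' \<in> C" for R R'
    using assms that by (auto simp: subset_chain_def)
  show ?thesis
    unfolding partial_character_def
  proof (intro conjI allI impI)
    show "(0, 1) \<in> \<Union>C" using assms(1) C partial_characterD(1) by blast
    show "cmod a = 1" if "(x, a) \<in> \<Union>C" for x a using that C partial_characterD(2) by blast
    show "a = 1" if "(0, a) \<in> \<Union>C" for a using that C partial_characterD(4) by blast
    show "(x - y, a / b) \<in> \<Union>C" if xy: "(x, a) \<in> \<Union>C" "(y, b) \<in> \<Union>C" for x a y b
    proof -
      obtain R R' where "(x, a) \<in> R" "(y, b) \<in> R'" "R \<in> C" "R' \<in> C" using xy by blast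
      then obtain S where "(x, a) \<in> S" "(y, b) \<in> S" "S \<in> C" using ch [of R R'] by blast
      then show ?thesis using C partial_characterD(3) by blast
    qed
  qed
qed

text \<open>This is injectivity of the circle as an abelian group: a maximal partial character is
  total, since a missing point could still be added.\<close>

theorem partial_character_extend:
  assumes "partial_character R"
  obtains \<phi> where "character \<phi>" "\<And>x a. (x, a) \<in> R \<Longrightarrow> \<phi> x = a"
proof -
  have "\<exists>M\<in>{S. partial_character S \<and> R \<subseteq> S}. \<forall>X\<in>{S. partial_character S \<and> R \<subseteq> S}. M \<subseteq> X \<longrightarrow> X = M"
  proof (rule subset_Zorn_nonempty)
    show "{S. partial_character S \<and> R \<subseteq> S} \<noteq> {}" using assms by blast
    show "\<Union>C \<in> {S. partial_character S \<and> R \<subseteq> S}"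
      if "C \<noteq> {}" "subset.chain {S. partial_character S \<and> R \<subseteq> S} C" for C
      using that partial_character_Union [of C] by (auto simp: subset_chain_def)
  qed
  then obtain M where "M \<in> {S. partial_character S \<and> R \<subseteq> S}"
    and max: "\<forall>X\<in>{S. partial_character S \<and> R \<subseteq> S}. M \<subseteq> X \<longrightarrow> X = M" ..
  then have M: "partial_character M" "R \<subseteq> M" by simp_all
  have "\<exists>a. (x, a) \<in> M" for x
  proof -
    obtain S where S: "partial_character S" "M \<subseteq> S" "x \<in> Domain S"
      using partial_character_insert_exists [OF M(1)] by blast
    have "S = M" using max S(1,2) M(2) by simp
    then show ?thesis using S(3) by auto
  qed
  then obtain \<phi> where \<phi>: "(x, \<phi> x) \<in> M" for x by metis
  have "\<phi> (x + y) = \<phi> x * \<phi> y" for x y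
    using partial_character_unique [OF M(1) \<phi> partial_character_add [OF M(1) \<phi> \<phi>]] .
  then have "character \<phi>" using partial_characterD(2) [OF M(1) \<phi>] by (simp add: character_def)
  moreover have "\<phi> x = a" if "(x, a) \<in> R" for x a
    using partial_character_unique [OF M(1) \<phi>] that M(2) by blast
  ultimately show ?thesis using that by blast
qed

lemma partial_character_trivial: "zm.subspace S \<Longrightarrow> partial_character (S \<times> {1})"
  by (auto simp: partial_character_def zm.subspace_0 zm.subspace_diff)

lemma character_trivial_on_extend:
  assumes S: "zm.subspace S" and c: "cmod c = 1"
    and rel: "\<And>k. zmul k x \<in> S \<Longrightarrow> c powi k = 1"
  obtains \<phi> where "character \<phi>" "\<And>y. y \<in> S \<Longrightarrow> \<phi> y = 1" "\<phi> x = c"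
proof -
  obtain R where R: "partial_character R" "S \<times> {1} \<subseteq> R" "(x, c) \<in> R"
    using partial_character_insert [OF partial_character_trivial [OF S] c, of x] rel by auto
  obtain \<phi> where \<phi>: "character \<phi>" "\<And>x a. (x, a) \<in> R \<Longrightarrow> \<phi> x = a"
    using partial_character_extend [OF R(1)] by blast
  show ?thesis
    by (rule that [of \<phi>]) (use \<phi> R(2,3) in auto)
qed

lemma cis_2pi_div_power_int: "n > 0 \<Longrightarrow> cis (2 * pi / real n) powi (int n * j) = 1"
  by (simp add: power_int_mult Complex.DeMoivre)

text \<open>The value at \<open>x\<close> is dictated by its order modulo \<open>S\<close>: -1 if
  the order is infinite, a primitive \<open>n\<close>-th root of unity if it is \<open>n\<close>,
  where \<open>n \<ge> 2\<close> because \<open>x\<close> is outside \<open>S\<close>.\<close>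

lemma character_separates:
  assumes S: "zm.subspace S" and x: "x \<notin> S"
  obtains \<phi> where "character \<phi>" "\<And>y. y \<in> S \<Longrightarrow> \<phi> y = 1" "\<phi> x \<noteq> 1"
proof (cases "\<exists>k. k \<noteq> 0 \<and> zmul k x \<in> S")
  case False
  have "(-1 :: complex) powi k = 1" if "zmul k x \<in> S" for k
    using False that by (cases "k = 0") auto
  then obtain \<phi> where "character \<phi>" "\<And>y. y \<in> S \<Longrightarrow> \<phi> y = 1" "\<phi> x = -1"
    using character_trivial_on_extend [OF S, of "-1" x] by auto
  then show ?thesis using that [of \<phi>] by simp
next
  case True
  then obtain k where k: "k \<noteq> 0" "zmul k x \<in> S" by blast
  define n where "n = (LEAST n::nat. n > 0 \<and> zmul (int n) x \<in> S)"
  note n = least_multiple_dvd [OF S n_def k]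
  have "n \<noteq> 1" using n(2) x by auto
  then have n2: "n \<ge> 2" using n(1) by simp
  have "cis (2 * pi / n) powi k = 1" if "zmul k x \<in> S" for k
    using n(3) [OF that] n(1) cis_2pi_div_power_int by (elim dvdE) simp
  then obtain \<phi> where \<phi>: "character \<phi>" "\<And>y. y \<in> S \<Longrightarrow> \<phi> y = 1" "\<phi> x = cis (2 * pi / n)"
    using character_trivial_on_extend [OF S, of "cis (2 * pi / n)" x] by auto
  have "cis (2 * pi / n) \<noteq> 1"
  proof
    assume "cis (2 * pi / n) = 1"
    then have "cos (2 * pi / n) = 1" by (metis cis.simps(1) one_complex.simps(1))
    moreover have "cos (2 * pi / n) < cos 0"
      using n2 by (intro cos_monotone_0_pi) (auto simp: field_simps)
    ultimately show False by simp
  qed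
  then show ?thesis using that [of \<phi>] \<phi> by auto
qed

section \<open>Bounded groups\<close>

lemma group_topologyD:
  assumes "group_topology T"
  shows "topspace T = UNIV" "continuous_map (prod_topology T T) T (\<lambda>(x, y). x + y)"
    "continuous_map T T uminus"
  using assms by (auto simp: group_topology_def)

lemma continuous_map_group_add:
  assumes T: "group_topology T" and "continuous_map X T f" "continuous_map X T g"
  shows "continuous_map X T (\<lambda>x. f x + g x)"
proof -
  have "continuous_map X (prod_topology T T) (\<lambda>x. (f x, g x))"
    using assms by (simp add: continuous_map_pairwise o_def)
  from continuous_map_compose [OF this group_topologyD(2) [OF T]]
  show ?thesis by (simp add: o_def)
qed

lemma continuous_map_zmul:
  assumes T: "group_topology T"
  shows "continuous_map T T (zmul (int n))"
proof (induction n)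
  case 0
  then show ?case using group_topologyD(1) [OF T] by (simp add: zm.scale_zero_left [abs_def])
next
  case (Suc n)
  have "zmul (int (Suc n)) = (\<lambda>x :: 'a. zmul (int n) x + x)"
    using zmul_add1 [of "int n"] by (auto simp: add.commute)
  then show ?case using continuous_map_group_add [OF T Suc continuous_map_id [unfolded id_def]] by simp
qed

lemma openin_translate:
  assumes T: "group_topology T" and U: "openin T U"
  shows "openin T {x. x + a \<in> U}"
proof -
  have "continuous_map T T (\<lambda>x. x + a)"
    using group_topologyD(1) [OF T] by (intro continuous_map_group_add [OF T]) (auto simp: continuous_map_const)
  from openin_continuous_map_preimage [OF this U] show ?thesis
    by (simp add: group_topologyD(1) [OF T])
qed

lemma openin_by_translates:
  assumes T: "group_topology T"
    and "\<And>x. x \<in> U \<Longrightarrow> \<exists>V. openin T V \<and> 0 \<in> V \<and> (\<forall>y\<in>V. y + x \<in> U)"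
  shows "openin T U"
proof (subst openin_subopen, intro ballI)
  fix x assume "x \<in> U"
  then obtain V where V: "openin T V" "0 \<in> V" "\<forall>y\<in>V. y + x \<in> U" using assms(2) by blast
  have "{y. y + - x \<in> V} \<subseteq> U" using V(3) by force
  then show "\<exists>W. openin T W \<and> x \<in> W \<and> W \<subseteq> U"
    using openin_translate [OF T V(1), of "- x"] V(2)
    by (intro exI [of _ "{y. y + - x \<in> V}"]) simp
qed

lemma openin_subgroup:
  assumes T: "group_topology T" and S: "zm.subspace S" and V: "openin T V" "0 \<in> V" "V \<subseteq> S"
  shows "openin T S"
  using V zm.subspace_add [OF S] by (intro openin_by_translates [OF T] exI [of _ V]) auto

lemma dual_group_character: "group_topology T \<Longrightarrow> \<phi> \<in> dual_group T \<Longrightarrow> character \<phi>"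
  by (auto simp: dual_group_def character_def circle_def continuous_map_in_subtopology
      group_topologyD(1) Pi_iff image_subset_iff)

lemma dual_group_continuous_at_0:
  assumes T: "group_topology T" and \<phi>: "\<phi> \<in> dual_group T" and "e > 0"
  obtains V where "openin T V" "0 \<in> V" "\<And>x. x \<in> V \<Longrightarrow> cmod (\<phi> x - 1) < e"
proof -
  have "continuous_map T euclidean \<phi>"
    using \<phi> by (auto simp: dual_group_def continuous_map_in_subtopology)
  then have "openin T {x \<in> topspace T. \<phi> x \<in> ball 1 e}"
    by (rule openin_continuous_map_preimage) simp
  then have "openin T {x. cmod (\<phi> x - 1) < e}"
    by (simp add: group_topologyD(1) [OF T] dist_norm norm_minus_commute)
  then show ?thesis
    using that dual_group_character [OF T \<phi>] \<open>e > 0\<close> by force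
qed

lemma dual_groupI:
  assumes T: "group_topology T" and \<phi>: "character \<phi>"
    and cont: "\<And>e. e > 0 \<Longrightarrow> \<exists>V. openin T V \<and> 0 \<in> V \<and> (\<forall>x\<in>V. cmod (\<phi> x - 1) < e)"
  shows "\<phi> \<in> dual_group T"
proof -
  have "openin T {x. \<phi> x \<in> W}" if W: "open W" for W
  proof (rule openin_by_translates [OF T])
    fix x assume "x \<in> {x. \<phi> x \<in> W}"
    then obtain e where e: "e > 0" "ball (\<phi> x) e \<subseteq> W" using W openE by blast
    obtain V where V: "openin T V" "0 \<in> V" "\<forall>y\<in>V. cmod (\<phi> y - 1) < e"
      using cont [OF e(1)] by blast
    have "\<phi> (y + x) \<in> W" if "y \<in> V" for y
    proof -
      have "cmod (\<phi> x - \<phi> (y + x)) = cmod ((1 - \<phi> y) * \<phi> x)"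
        by (simp add: character_add [OF \<phi>] algebra_simps)
      also have "\<dots> = cmod (\<phi> y - 1)" using \<phi> by (simp add: norm_mult norm_minus_commute)
      finally have "\<phi> (y + x) \<in> ball (\<phi> x) e" using V(3) that by (simp add: dist_norm)
      then show ?thesis using e(2) by blast
    qed
    then show "\<exists>V. openin T V \<and> 0 \<in> V \<and> (\<forall>y\<in>V. y + x \<in> {x. \<phi> x \<in> W})"
      using V by blast
  qed
  then have "continuous_map T euclidean \<phi>"
    by (simp add: continuous_map_def group_topologyD(1) [OF T])
  then show ?thesis
    using \<phi> by (auto simp: dual_group_def continuous_map_in_subtopology circle_def character_def)
qed

lemma dual_group_trivial_on_open:
  assumes "group_topology T" "character \<phi>" "openin T V" "0 \<in> V" "\<And>x. x \<in> V \<Longrightarrow> \<phi> x = 1"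
  shows "\<phi> \<in> dual_group T"
  using assms by (intro dual_groupI) auto

text \<open>If \<open>z\<close> were not 1, its first \<open>m\<close> powers would sum to 0, while
  their real parts are nonnegative and the power 0 contributes 1.\<close>

lemma root_of_unity_eq_1:
  fixes z :: complex
  assumes m: "m > 0" "z ^ m = 1" and "\<And>j. j < m \<Longrightarrow> Re (z ^ j) \<ge> 0"
  shows "z = 1"
proof (rule ccontr)
  assume "z \<noteq> 1"
  then have "(\<Sum>j<m. z ^ j) = 0" using m by (simp add: geometric_sum)
  then have "(\<Sum>j<m. Re (z ^ j)) = 0" by (metis Re_sum zero_complex.simps(1))
  moreover have "(\<Sum>j<m. Re (z ^ j)) \<ge> (\<Sum>j\<in>{0}. Re (z ^ j))"
    using assms by (intro sum_mono2) auto
  ultimately show False by simp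
qed

lemma open_all_multiples:
  assumes T: "group_topology T" and U: "openin T U" "0 \<in> U"
  obtains V where "openin T V" "0 \<in> V" "\<And>x j. x \<in> V \<Longrightarrow> j < m \<Longrightarrow> zmul (int j) x \<in> U"
proof -
  \<comment> \<open>The range up to \<open>Suc m\<close> keeps the index set of the intersection
    nonempty when \<open>m = 0\<close>.\<close>
  have "openin T (\<Inter>j\<in>{..<Suc m}. {x \<in> topspace T. zmul (int j) x \<in> U})"
    by (intro openin_INT2 openin_continuous_map_preimage [OF continuous_map_zmul [OF T] U(1)]) auto
  then have "openin T {x. \<forall>j<Suc m. zmul (int j) x \<in> U}"
    by (rule back_subst) (auto simp: group_topologyD(1) [OF T])
  then show ?thesis by (rule that) (use U in auto)
qed

lemma bounded_character_root:
  assumes "\<And>x::'a::ab_group_add. zmul (int m) x = 0" "character \<phi>"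
  shows "\<phi> (x::'a) ^ m = 1"
  using character_zmul [OF assms(2), of "int m" x] assms by simp

text \<open>Near 0 the first \<open>m\<close> multiples of a point all have values within 1 of 1,
  hence in the right half plane; since the value is an \<open>m\<close>-th root of unity, it is
  1.\<close>

lemma bounded_dual_group_locally_trivial:
  fixes T :: "'a::ab_group_add topology"
  assumes T: "group_topology T" and m: "m > 0" "\<And>x::'a. zmul (int m) x = 0"
    and \<phi>: "\<phi> \<in> dual_group T"
  obtains V where "openin T V" "0 \<in> V" "\<And>x. x \<in> V \<Longrightarrow> \<phi> x = 1"
proof -
  note ch = dual_group_character [OF T \<phi>]
  obtain U where U: "openin T U" "0 \<in> U" "\<And>x. x \<in> U \<Longrightarrow> cmod (\<phi> x - 1) < 1"
    using dual_group_continuous_at_0 [OF T \<phi>, of 1] by auto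
  obtain V where V: "openin T V" "0 \<in> V" "\<And>x j. x \<in> V \<Longrightarrow> j < m \<Longrightarrow> zmul (int j) x \<in> U"
    using open_all_multiples [OF T U(1,2)] by blast
  have "\<phi> x = 1" if "x \<in> V" for x
  proof (rule root_of_unity_eq_1 [OF m(1) bounded_character_root [OF m(2) ch]])
    fix j assume "j < m"
    have "\<bar>Re (\<phi> x ^ j - 1)\<bar> < 1"
      using U(3) [OF V(3) [OF that \<open>j < m\<close>]] abs_Re_le_cmod [of "\<phi> x ^ j - 1"]
      by (simp add: character_zmul [OF ch])
    then show "Re (\<phi> x ^ j) \<ge> 0" by simp
  qed
  then show ?thesis using that V by blast
qed

text \<open>\<open>S\<close> is the common kernel of the continuous characters mapping
  \<open>M\<close> into the right half plane. Quasi-convexity gives \<open>S \<subseteq> M\<close>;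
  conversely a point whose first \<open>m\<close> multiples lie in \<open>M\<close> is in
  \<open>S\<close>, because the values are roots of unity.\<close>

lemma bounded_locally_quasi_convex_linear:
  fixes T :: "'a::ab_group_add topology"
  assumes T: "locally_quasi_convex T" and m: "m > 0" "\<And>x::'a. zmul (int m) x = 0"
    and U: "openin T U" "0 \<in> U"
  obtains S where "zm.subspace S" "openin T S" "S \<subseteq> U"
proof -
  have gT: "group_topology T" using T by (simp add: locally_quasi_convex_def)
  obtain M W where MW: "quasi_convex T M" "openin T W" "0 \<in> W" "W \<subseteq> M" "M \<subseteq> U"
    using T U unfolding locally_quasi_convex_def by metis
  obtain V where V: "openin T V" "0 \<in> V" "\<And>x j. x \<in> V \<Longrightarrow> j < m \<Longrightarrow> zmul (int j) x \<in> W"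
    using open_all_multiples [OF gT MW(2,3)] by blast
  define P where "P = {\<phi> \<in> dual_group T. \<phi> ` M \<subseteq> circle_plus}"
  define S where "S = {x. \<forall>\<phi>\<in>P. \<phi> x = 1}"
  have ch: "character \<phi>" if "\<phi> \<in> P" for \<phi>
    using that dual_group_character [OF gT] by (auto simp: P_def)
  have S: "zm.subspace S"
    by (auto simp: zm.subspace_def S_def ch character_add character_zmul)
  have "V \<subseteq> S"
  proof
    fix x assume x: "x \<in> V"
    have "\<phi> x = 1" if \<phi>: "\<phi> \<in> P" for \<phi>
    proof (rule root_of_unity_eq_1 [OF m(1) bounded_character_root [OF m(2) ch [OF \<phi>]]])
      fix j assume "j < m"
      then have "zmul (int j) x \<in> M" using V(3) x MW(4) by blast
      then have "\<phi> (zmul (int j) x) \<in> circle_plus" using \<phi> by (auto simp: P_def)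
      then show "Re (\<phi> x ^ j) \<ge> 0" by (simp add: circle_plus_def character_zmul [OF ch [OF \<phi>]])
    qed
    then show "x \<in> S" by (simp add: S_def)
  qed
  moreover have "S \<subseteq> M"
  proof
    fix x assume x: "x \<in> S"
    have "(1 :: complex) \<in> circle_plus" by (simp add: circle_plus_def circle_def)
    then show "x \<in> M" using x MW(1) unfolding quasi_convex_def S_def P_def by force
  qed
  ultimately show ?thesis
    using that S openin_subgroup [OF gT S V(1,2)] MW(5) by blast
qed

text \<open>Each new generator multiplies the number of cosets of \<open>H\<close> by at most
  \<open>m\<close>, since its coefficient matters only modulo \<open>m\<close>.\<close>

lemma bounded_finitely_many_cosets:
  fixes H :: "'a::ab_group_add set"
  assumes m: "m > 0" "\<And>x::'a. zmul (int m) x = 0"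
    and H: "zm.subspace H" and F: "finite F"
  shows "\<exists>C. finite C \<and> (\<forall>y\<in>zm.span (H \<union> F). \<exists>c\<in>C. y - c \<in> H)"
  using F
proof (induction F)
  case empty
  have "zm.span H \<subseteq> H" by (rule zm.span_minimal) (simp_all add: H)
  then show ?case by (intro exI [of _ "{0}"]) auto
next
  case (insert a F)
  then obtain C where C: "finite C" "\<And>y. y \<in> zm.span (H \<union> F) \<Longrightarrow> \<exists>c\<in>C. y - c \<in> H" by blast
  define C' where "C' = (\<lambda>(j, c). zmul j a + c) ` ({0..<int m} \<times> C)"
  have "\<exists>c\<in>C'. y - c \<in> H" if y: "y \<in> zm.span (H \<union> insert a F)" for y
  proof -
    obtain k where k: "y - zmul k a \<in> zm.span (H \<union> F)"
      using y zm.span_breakdown_eq [of y a "H \<union> F"] by auto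
    have "zmul (int m * (k div int m)) a = 0"
      using m(2) [of "zmul (k div int m) a"] by simp
    then have *: "zmul k a = zmul (k mod int m) a"
      using zmul_add_left [of "int m * (k div int m)" "k mod int m" a] by simp
    obtain c where c: "c \<in> C" "y - zmul (k mod int m) a - c \<in> H" using C(2) [OF k] * by auto
    have "zmul (k mod int m) a + c \<in> C'"
      unfolding C'_def using c(1) m(1) by (intro image_eqI [of _ _ "(k mod int m, c)"]) auto
    then show ?thesis using c(2) by (metis diff_diff_eq)
  qed
  moreover have "finite C'" unfolding C'_def using C(1) by simp
  ultimately show ?case by blast
qed

text \<open>The character is fixed successively on the subgroups generated by \<open>H\<close> and the first \<open>n\<close>
  members of the sequence; each step is free to avoid the value \<open>1\<close> at a new member.\<close>

lemma character_nontrivial_on_independent: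
  fixes x :: "nat \<Rightarrow> 'a::ab_group_add"
  assumes H: "zm.subspace H"
  obtains \<psi> where "character \<psi>" "\<And>y. y \<in> H \<Longrightarrow> \<psi> y = 1"
    "\<And>n. x n \<notin> zm.span (H \<union> x ` {..<n}) \<Longrightarrow> \<psi> (x n) \<noteq> 1"
proof -
  define S where "S n = zm.span (H \<union> x ` {..<n})" for n
  have S: "zm.subspace (S n)" for n by (simp add: S_def)
  have S_mono: "S m \<subseteq> S n" if "m \<le> n" for m n
    unfolding S_def by (rule zm.span_mono) (use that in auto)
  have x_S: "x n \<in> S (Suc n)" for n unfolding S_def by (rule zm.span_base) auto
  have "\<exists>g. character g \<and> (\<forall>y\<in>S n. g y = 1) \<and> (x n \<notin> S n \<longrightarrow> g (x n) \<noteq> 1)" for n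
  proof (cases "x n \<in> S n")
    case True
    then show ?thesis by (intro exI [of _ "\<lambda>_. 1"]) (simp add: character_def)
  next
    case False
    then show ?thesis using character_separates [OF S False] by metis
  qed
  then obtain g where g: "character (g n)" "\<And>y. y \<in> S n \<Longrightarrow> g n y = 1"
    "x n \<notin> S n \<Longrightarrow> g n (x n) \<noteq> 1" for n by metis
  \<comment> \<open>The factor \<open>g n\<close> is used only if the value at \<open>x n\<close> is
    still 1. Being trivial on \<open>S n\<close>, it leaves the values fixed earlier
    untouched.\<close>
  define f where "f = rec_nat (\<lambda>_. 1) (\<lambda>n f y. if f (x n) \<noteq> 1 then f y else f y * g n y)"
  have f_0: "f 0 = (\<lambda>_. 1)" by (simp add: f_def)
  have f_Suc: "f (Suc n) = (\<lambda>y. if f n (x n) \<noteq> 1 then f n y else f n y * g n y)" for n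
    unfolding f_def by simp
  have ch: "character (f n)" for n
  proof (induction n)
    case 0
    then show ?case by (simp add: f_0 character_def)
  next
    case (Suc n)
    then show ?case using character_mult [OF Suc g(1)] by (cases "f n (x n) = 1") (simp_all add: f_Suc)
  qed
  have f_eq: "f n y = f m y" if "m \<le> n" "y \<in> S m" for m n y
    using that(1)
  proof (induction n rule: dec_induct)
    case (step n)
    then show ?case using g(2) S_mono [OF step(1)] that(2) by (auto simp: f_Suc)
  qed simp
  \<comment> \<open>The \<open>f n\<close> are known to stabilize only on the union of the
    \<open>S n\<close>, so their limit is a partial character that still has to be extended.\<close>
  define R where "R = {(y, f n y) | n y. y \<in> S n}"
  have RI: "(y, f n y) \<in> R" if "y \<in> S n" for y n using that unfolding R_def by blast
  have "partial_character R"
    unfolding partial_character_def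
  proof (intro conjI allI impI)
    show "(0, 1) \<in> R" using RI [of 0 0] zm.subspace_0 [OF S] by (simp add: f_0)
    show "cmod a = 1" if "(y, a) \<in> R" for y a using that ch by (auto simp: R_def)
    show "a = 1" if "(0, a) \<in> R" for a using that ch by (auto simp: R_def)
    show "(y - z, a / b) \<in> R" if yz: "(y, a) \<in> R" "(z, b) \<in> R" for y z a b
    proof -
      obtain n k where 1: "y \<in> S n" "a = f n y" "z \<in> S k" "b = f k z"
        using yz unfolding R_def by blast
      define l where "l = max n k"
      have "a = f l y" "b = f l z" "y \<in> S l" "z \<in> S l"
        using 1 f_eq [of n l y] f_eq [of k l z] S_mono [of n l] S_mono [of k l] by (auto simp: l_def)
      then show ?thesis using RI [of "y - z" l] S by (simp add: character_diff [OF ch] zm.subspace_diff)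
    qed
  qed
  then obtain \<psi> where \<psi>: "character \<psi>" "\<And>y a. (y, a) \<in> R \<Longrightarrow> \<psi> y = a"
    using partial_character_extend by blast
  have "\<psi> y = 1" if "y \<in> H" for y
  proof -
    have "y \<in> S 0" unfolding S_def by (rule zm.span_base) (use that in auto)
    then show ?thesis using \<psi>(2) [OF RI] by (simp add: f_0)
  qed
  moreover have "\<psi> (x n) \<noteq> 1" if "x n \<notin> S n" for n
    using \<psi>(2) [OF RI [OF x_S]] g(3) [OF that] by (auto simp: f_Suc)
  ultimately show ?thesis using that \<psi>(1) unfolding S_def by blast
qed

text \<open>Either, at arbitrarily large indices, the sequence leaves each subgroup generated by
  \<open>H\<close> and an initial segment; then infinitely many members are independent of
  \<open>H\<close> and their predecessors. Or its tail stays in one such subgroup, where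
  \<open>H\<close> has finite index, and infinitely many members share a coset of
  \<open>H\<close>.\<close>

lemma bounded_character_nontrivial_infinitely_often:
  fixes x :: "nat \<Rightarrow> 'a::ab_group_add"
  assumes m: "m > 0" "\<And>x::'a. zmul (int m) x = 0"
    and H: "zm.subspace H" and x: "\<And>n. x n \<notin> H"
  obtains \<psi> where "character \<psi>" "\<And>y. y \<in> H \<Longrightarrow> \<psi> y = 1" "\<And>N. \<exists>n\<ge>N. \<psi> (x n) \<noteq> 1"
proof (cases "\<forall>N. \<exists>n\<ge>N. x n \<notin> zm.span (H \<union> x ` {..<N})")
  case True
  have "\<exists>n\<ge>N. x n \<notin> zm.span (H \<union> x ` {..<n})" for N
  proof -
    \<comment> \<open>Minimality of \<open>n\<close> keeps all earlier members inside the span for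
      \<open>N\<close>; adding them does not enlarge it, so \<open>x n\<close> is outside the span
      for \<open>n\<close> too.\<close>
    define n where "n = (LEAST n. n \<ge> N \<and> x n \<notin> zm.span (H \<union> x ` {..<N}))"
    have n: "n \<ge> N" "x n \<notin> zm.span (H \<union> x ` {..<N})"
      using LeastI_ex [OF spec [OF True, of N]] unfolding n_def by auto
    have "x i \<in> zm.span (H \<union> x ` {..<N})" if "i < n" for i
    proof (cases "i < N")
      case True
      then show ?thesis by (intro zm.span_base) auto
    next
      case False
      then show ?thesis using that not_less_Least unfolding n_def by (metis not_less)
    qed
    moreover have "H \<subseteq> zm.span (H \<union> x ` {..<N})" using zm.span_superset by blast
    ultimately have "H \<union> x ` {..<n} \<subseteq> zm.span (H \<union> x ` {..<N})" by auto
    then have "zm.span (H \<union> x ` {..<n}) \<subseteq> zm.span (H \<union> x ` {..<N})"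
      by (rule zm.span_minimal) simp
    then show ?thesis using n by blast
  qed
  then show ?thesis using character_nontrivial_on_independent [OF H, of x] that by metis
next
  case False
  then obtain N where N: "\<And>n. n \<ge> N \<Longrightarrow> x n \<in> zm.span (H \<union> x ` {..<N})" by blast
  obtain C where C: "finite C" "\<And>y. y \<in> zm.span (H \<union> x ` {..<N}) \<Longrightarrow> \<exists>c\<in>C. y - c \<in> H"
    using bounded_finitely_many_cosets [OF m H, of "x ` {..<N}"] by auto
  have "\<forall>n\<in>{N..}. \<exists>c\<in>C. x n - c \<in> H" using C(2) N by simp
  from pigeonhole_infinite_rel [OF infinite_Ici C(1) this]
  obtain c where c: "infinite {n\<in>{N..}. x n - c \<in> H}" by auto
  then obtain n0 where "x n0 - c \<in> H" using not_finite_existsD by blast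
  then have "c \<notin> H" using x [of n0] zm.subspace_add [OF H, of "x n0 - c" c] by auto
  then obtain \<psi> where \<psi>: "character \<psi>" "\<And>y. y \<in> H \<Longrightarrow> \<psi> y = 1" "\<psi> c \<noteq> 1"
    using character_separates [OF H] by blast
  have "\<exists>n\<ge>k. \<psi> (x n) \<noteq> 1" for k
  proof -
    obtain n where n: "n \<ge> k" "x n - c \<in> H"
      using c unfolding infinite_nat_iff_unbounded_le by blast
    have "\<psi> (x n) = \<psi> c" using \<psi>(2) [OF n(2)] \<psi>(1) by (simp add: character_diff)
    then show ?thesis using n(1) \<psi>(3) by auto
  qed
  then show ?thesis using that \<psi> by blast
qed

text \<open>Metrizability enters the bounded case through this base at 0: it turns a subgroup that
  is not open into a null sequence outside it.\<close>

lemma metrizable_countable_base: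
  assumes "metrizable_space T" "a \<in> topspace T"
  obtains B :: "nat \<Rightarrow> 'a set" where "\<And>n. openin T (B n)" "\<And>n. a \<in> B n"
    "\<And>V. openin T V \<Longrightarrow> a \<in> V \<Longrightarrow> \<exists>N. \<forall>n\<ge>N. B n \<subseteq> V"
proof -
  obtain M d where Md: "Metric_space M d" "T = Metric_space.mtopology M d"
    using assms(1) unfolding metrizable_space_def by blast
  interpret Metric_space M d by (rule Md(1))
  have a: "a \<in> M" using assms(2) Md(2) by simp
  have "\<exists>N. \<forall>n\<ge>N. mball a (1 / Suc n) \<subseteq> V" if V: "openin T V" "a \<in> V" for V
  proof -
    obtain r where r: "r > 0" "mball a r \<subseteq> V" using V unfolding Md(2) openin_mtopology by blast
    obtain N where N: "1 / real (Suc N) < r" using nat_approx_posE [OF r(1)] by blast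
    have "mball a (1 / Suc n) \<subseteq> V" if "n \<ge> N" for n
    proof -
      have "1 / real (Suc n) \<le> 1 / real (Suc N)" using that by (simp add: frac_le)
      then have "1 / real (Suc n) \<le> r" using N by simp
      then show ?thesis using mball_subset_concentric r(2) by blast
    qed
    then show ?thesis by blast
  qed
  then show ?thesis using that [of "\<lambda>n. mball a (1 / Suc n)"] a by (auto simp: Md(2))
qed

theorem bounded_metrizable_mackey:
  fixes T :: "'a::ab_group_add topology"
  assumes m: "m > 0" "\<And>x::'a. zmul (int m) x = 0"
    and T: "metrizable_space T" "locally_quasi_convex T"
  shows "mackey T"
  unfolding mackey_def
proof (intro conjI allI impI)
  fix N :: "'a topology" and U
  assume "locally_quasi_convex N \<and> compatible N T" and U: "openin N U"
  then have lqc: "locally_quasi_convex N" and dual: "dual_group N = dual_group T"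
    by (simp_all add: compatible_def)
  have gT: "group_topology T" and gN: "group_topology N"
    using T(2) lqc by (simp_all add: locally_quasi_convex_def)
  \<comment> \<open>Open subgroups suffice: by \<open>bounded_locally_quasi_convex_linear\<close>
    they form a base at 0 for \<open>N\<close>.\<close>
  have open_T: "openin T H" if H: "zm.subspace H" "openin N H" for H
  proof (rule ccontr)
    assume nopen: "\<not> openin T H"
    have top: "0 \<in> topspace T" by (simp add: group_topologyD(1) [OF gT])
    obtain B :: "nat \<Rightarrow> 'a set" where B: "\<And>n. openin T (B n)" "\<And>n. 0 \<in> B n"
      "\<And>V. openin T V \<Longrightarrow> 0 \<in> V \<Longrightarrow> \<exists>k. \<forall>n\<ge>k. B n \<subseteq> V"
      using metrizable_countable_base [OF T(1) top] by blast
    have "\<exists>x. x \<in> B n \<and> x \<notin> H" for n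
      using openin_subgroup [OF gT H(1) B(1,2), of n] nopen by blast
    then obtain x where x: "\<And>n. x n \<in> B n" "\<And>n. x n \<notin> H" by metis
    obtain \<psi> where \<psi>: "character \<psi>" "\<And>y. y \<in> H \<Longrightarrow> \<psi> y = 1" "\<And>k. \<exists>n\<ge>k. \<psi> (x n) \<noteq> 1"
      using bounded_character_nontrivial_infinitely_often [OF m H(1), of x] x(2) by blast
    have "\<psi> \<in> dual_group T"
      using dual_group_trivial_on_open [OF gN \<psi>(1) H(2) zm.subspace_0 [OF H(1)] \<psi>(2)] dual by simp
    then obtain V where V: "openin T V" "0 \<in> V" "\<And>x. x \<in> V \<Longrightarrow> \<psi> x = 1"
      using bounded_dual_group_locally_trivial [OF gT m] by metis
    then show False using B(3) [OF V(1,2)] x(1) \<psi>(3) by blast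
  qed
  show "openin T U"
  proof (rule openin_by_translates [OF gT])
    fix x assume "x \<in> U"
    then obtain H where H: "zm.subspace H" "openin N H" "H \<subseteq> {y. y + x \<in> U}"
      using bounded_locally_quasi_convex_linear [OF lqc m openin_translate [OF gN U, of x]] by auto
    then show "\<exists>V. openin T V \<and> 0 \<in> V \<and> (\<forall>y\<in>V. y + x \<in> U)"
      using open_T zm.subspace_0 by blast
  qed
qed (rule T(2))

section \<open>Group norms and suprema of characters\<close>

lemma norm_cis_minus_1_le: "cmod (cis t - 1) \<le> \<bar>t\<bar>"
proof -
  have "(cmod (cis t - 1))\<^sup>2 = (cos t - 1)\<^sup>2 + (sin t)\<^sup>2" by (simp add: cmod_power2)
  also have "\<dots> = (2 * sin (t / 2))\<^sup>2"
    using sin_cos_squared_add [of t] cos_double_sin [of "t / 2"]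
    by (simp add: power2_eq_square algebra_simps)
  finally have "cmod (cis t - 1) = \<bar>2 * sin (t / 2)\<bar>"
    using power2_eq_iff_nonneg [of "cmod (cis t - 1)" "\<bar>2 * sin (t / 2)\<bar>"] by simp
  then show ?thesis using abs_sin_x_le_abs_x [of "t / 2"] by simp
qed

lemma cos_nonneg_imp_le: "0 \<le> x \<Longrightarrow> x \<le> pi \<Longrightarrow> cos x \<ge> 0 \<Longrightarrow> x \<le> pi / 2"
  using cos_monotone_0_pi [of "pi / 2" x] by (force simp: not_le [symmetric])

text \<open>Adding the angles one at a time, no partial sum can jump over the half plane \<open>Re z < 0\<close>.\<close>

lemma angle_sum_le:
  fixes a :: "nat \<Rightarrow> real" and t u :: "nat \<Rightarrow> nat"
  assumes a: "\<And>k. 0 \<le> a k" "\<And>k. a k \<le> pi"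
    and cos: "\<And>u. (\<And>k. u k \<le> t k) \<Longrightarrow> cos (\<Sum>k<N. real (u k) * a k) \<ge> 0"
    and u: "\<And>k. u k \<le> t k"
  shows "(\<Sum>k<N. real (u k) * a k) \<le> pi / 2"
  using u
proof (induction "\<Sum>k<N. u k" arbitrary: u)
  case 0
  then show ?case by simp
next
  case (Suc n)
  have "\<exists>k<N. u k \<noteq> 0"
  proof (rule ccontr)
    assume "\<not> ?thesis"
    then have "(\<Sum>k<N. u k) = 0" by simp
    then show False using Suc(2) by simp
  qed
  then obtain k where k: "k < N" "u k > 0" by auto
  define v where "v = u(k := u k - 1)"
  have single: "(\<Sum>i<N. real (if i = k then c else 0) * a i) = real c * a k" for c :: nat
    using k(1) by (subst sum.remove [of _ k]) auto
  have sum_u: "(\<Sum>i<N. f (u i) i) = f (u k) k + (\<Sum>i\<in>{..<N}-{k}. f (u i) i)"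
    "(\<Sum>i<N. f (v i) i) = f (u k - 1) k + (\<Sum>i\<in>{..<N}-{k}. f (u i) i)"
    for f :: "nat \<Rightarrow> nat \<Rightarrow> 'b::comm_monoid_add"
    using k(1) by (simp_all add: sum.remove [of _ k] v_def)
  have "n = (\<Sum>i<N. v i)"
    using Suc(2) sum_u [of "\<lambda>c _. c"] k(2) by simp
  moreover have "v i \<le> t i" for i using Suc(3) [of i] by (auto simp: v_def)
  ultimately have 1: "(\<Sum>i<N. real (v i) * a i) \<le> pi / 2" by (rule Suc(1))
  have "cos (\<Sum>i<N. real (if i = k then 1 else 0) * a i) \<ge> 0"
    by (rule cos) (use k(2) Suc(3) [of k] in auto)
  then have 2: "a k \<le> pi / 2"
    using cos_nonneg_imp_le a single [of 1] by (simp del: of_nat_sum)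
  have "(\<Sum>i<N. real (u i) * a i) = a k + (\<Sum>i<N. real (v i) * a i)"
    using sum_u [of "\<lambda>c i. real c * a i"] k(2) by (simp add: of_nat_diff algebra_simps)
  \<comment> \<open>The previous sum and the added angle are at most pi/2 each. On the range from 0
    to pi a nonnegative cosine then forces the total below pi/2 again.\<close>
  then have "(\<Sum>i<N. real (u i) * a i) \<le> pi" using 1 2 by linarith
  then show ?case using cos [OF Suc(3)] cos_nonneg_imp_le a(1) by (simp add: sum_nonneg)
qed

text \<open>Conditions on powers thus cut out arbitrarily small neighbourhoods of 1 in the circle,
  which is where the quasi-convex neighbourhoods come from. The proof is \<open>angle_sum_le\<close>
  for the single angle |Arg z| with multiplicity \<open>Suc K\<close>.\<close>

lemma circle_powers_nonneg_imp_small: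
  assumes "e > 0"
  obtains K :: nat where
    "\<And>z. cmod z = 1 \<Longrightarrow> (\<And>j. j \<le> K \<Longrightarrow> Re (z ^ j) \<ge> 0) \<Longrightarrow> cmod (z - 1) \<le> e"
proof -
  obtain K where K: "real (Suc K) > pi / 2 / e" using reals_Archimedean2 less_Suc_eq by (metis less_trans of_nat_less_iff)
  have "cmod (z - 1) \<le> e" if z: "cmod z = 1" "\<And>j. j \<le> Suc K \<Longrightarrow> Re (z ^ j) \<ge> 0" for z
  proof -
    define \<theta> where "\<theta> = Arg z"
    have cis: "z = cis \<theta>" using z(1) cis_Arg [of z] by (cases "z = 0") (auto simp: \<theta>_def sgn_div_norm)
    have "cos (\<Sum>k<1. real (u k) * \<bar>\<theta>\<bar>) \<ge> 0" if "\<And>k. u k \<le> Suc K" for u :: "nat \<Rightarrow> nat"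
    proof -
      have "cos (real (u 0) * \<bar>\<theta>\<bar>) = cos (real (u 0) * \<theta>)" by (cases "\<theta> \<ge> 0") (simp_all add: abs_if)
      then show ?thesis using z(2) [OF that, of 0] by (simp add: cis Complex.DeMoivre)
    qed
    from angle_sum_le [of "\<lambda>_. \<bar>\<theta>\<bar>" "\<lambda>_. Suc K" 1 "\<lambda>_. Suc K", OF _ _ this]
    have "real (Suc K) * \<bar>\<theta>\<bar> \<le> pi / 2"
      using Arg_bounded [of z] by (simp add: \<theta>_def abs_le_iff)
    moreover have "real (Suc K) * e > pi / 2" using K assms by (simp add: field_simps)
    ultimately have "real (Suc K) * \<bar>\<theta>\<bar> < real (Suc K) * e" by linarith
    then have "\<bar>\<theta>\<bar> < e" by (simp add: mult_less_cancel_left)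
    then show ?thesis using norm_cis_minus_1_le [of \<theta>] cis by simp
  qed
  then show ?thesis by (rule that)
qed

lemma norm_mult_minus_1_le:
  assumes "cmod a = 1"
  shows "cmod (a * b - 1) \<le> cmod (a - 1) + cmod (b - 1)"
proof -
  have "a * b - 1 = a * (b - 1) + (a - 1)" by (simp add: algebra_simps)
  then have "cmod (a * b - 1) \<le> cmod (a * (b - 1)) + cmod (a - 1)" by (metis norm_triangle_ineq)
  then show ?thesis using assms by (simp add: norm_mult)
qed

lemma norm_power_minus_1_le: "cmod a = 1 \<Longrightarrow> cmod (a ^ n - 1) \<le> real n * cmod (a - 1)"
  by (induction n) (auto simp: distrib_right intro: order_trans [OF norm_mult_minus_1_le])

lemma norm_inverse_minus_1: "cmod a = 1 \<Longrightarrow> cmod (inverse a - 1) = cmod (a - 1)"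
proof -
  assume a: "cmod a = 1"
  then have "a \<noteq> 0" by auto
  then have "inverse a - 1 = - (inverse a * (a - 1))" by (simp add: field_simps)
  then have "cmod (inverse a - 1) = cmod (inverse a * (a - 1))" by (metis norm_minus_cancel)
  then show ?thesis using a by (simp add: norm_mult norm_inverse)
qed

section \<open>Group structure of the dual\<close>

lemma dual_group_mult:
  assumes T: "group_topology T" and \<phi>: "\<phi> \<in> dual_group T" and \<psi>: "\<psi> \<in> dual_group T"
  shows "(\<lambda>x. \<phi> x * \<psi> x) \<in> dual_group T"
proof (rule dual_groupI [OF T])
  note ch = dual_group_character [OF T \<phi>] dual_group_character [OF T \<psi>]
  show "character (\<lambda>x. \<phi> x * \<psi> x)" using ch by (rule character_mult)
  fix e :: real assume "e > 0"
  obtain V where V: "openin T V" "0 \<in> V" "\<And>x. x \<in> V \<Longrightarrow> cmod (\<phi> x - 1) < e / 2"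
    using dual_group_continuous_at_0 [OF T \<phi>, of "e / 2"] \<open>e > 0\<close> by auto
  obtain W where W: "openin T W" "0 \<in> W" "\<And>x. x \<in> W \<Longrightarrow> cmod (\<psi> x - 1) < e / 2"
    using dual_group_continuous_at_0 [OF T \<psi>, of "e / 2"] \<open>e > 0\<close> by auto
  have "cmod (\<phi> x * \<psi> x - 1) < e" if "x \<in> V \<inter> W" for x
    using norm_mult_minus_1_le [of "\<phi> x" "\<psi> x"] V(3) [of x] W(3) [of x] that ch by auto
  then show "\<exists>V. openin T V \<and> 0 \<in> V \<and> (\<forall>x\<in>V. cmod (\<phi> x * \<psi> x - 1) < e)"
    using V W by (intro exI [of _ "V \<inter> W"]) auto
qed

lemma dual_group_inverse:
  assumes T: "group_topology T" and \<phi>: "\<phi> \<in> dual_group T"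
  shows "(\<lambda>x. inverse (\<phi> x)) \<in> dual_group T"
proof (rule dual_groupI [OF T])
  note ch = dual_group_character [OF T \<phi>]
  show "character (\<lambda>x. inverse (\<phi> x))" using character_powi [OF ch, of "-1"] by (simp add: power_int_minus)
  show "\<exists>V. openin T V \<and> 0 \<in> V \<and> (\<forall>x\<in>V. cmod (inverse (\<phi> x) - 1) < e)" if "e > 0" for e
    using dual_group_continuous_at_0 [OF T \<phi> that] ch by (metis norm_inverse_minus_1 character_norm)
qed

lemma dual_group_1: "group_topology T \<Longrightarrow> (\<lambda>_. 1) \<in> dual_group T"
  using openin_topspace [of T]
  by (intro dual_group_trivial_on_open [where V = UNIV])
     (auto simp: character_def group_topologyD(1))

lemma dual_group_power:
  "group_topology T \<Longrightarrow> \<phi> \<in> dual_group T \<Longrightarrow> (\<lambda>x. \<phi> x ^ n) \<in> dual_group T"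
  by (induction n) (simp_all add: dual_group_1 dual_group_mult)

lemma dual_group_powi:
  "group_topology T \<Longrightarrow> \<phi> \<in> dual_group T \<Longrightarrow> (\<lambda>x. \<phi> x powi k) \<in> dual_group T"
  by (cases "k \<ge> 0") (simp_all add: power_int_def dual_group_power dual_group_inverse)

lemma dual_group_prod:
  assumes "group_topology T" "\<And>i. i \<in> I \<Longrightarrow> \<phi> i \<in> dual_group T"
  shows "(\<lambda>x. \<Prod>i\<in>I. \<phi> i x) \<in> dual_group T"
  using assms(2)
  by (induction I rule: infinite_finite_induct)
     (simp_all add: dual_group_1 dual_group_mult assms(1))

lemma dual_group_cong_open:
  assumes "group_topology T" "\<phi> \<in> dual_group T" "character \<psi>" "openin T H" "0 \<in> H"
    "\<And>x. x \<in> H \<Longrightarrow> \<psi> x = \<phi> x"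
  shows "\<psi> \<in> dual_group T"
proof (rule dual_groupI [OF assms(1,3)])
  fix e :: real assume "e > 0"
  then obtain V where V: "openin T V" "0 \<in> V" "\<And>x. x \<in> V \<Longrightarrow> cmod (\<phi> x - 1) < e"
    using dual_group_continuous_at_0 [OF assms(1,2)] by metis
  then show "\<exists>V. openin T V \<and> 0 \<in> V \<and> (\<forall>x\<in>V. cmod (\<psi> x - 1) < e)"
    using assms(4-6) by (intro exI [of _ "V \<inter> H"]) auto
qed

section \<open>Translation-invariant metrics, presented by the distance to 0\<close>

definition group_norm :: "('a::ab_group_add \<Rightarrow> real) \<Rightarrow> bool" where
  "group_norm p \<longleftrightarrow> (\<forall>x. 0 \<le> p x) \<and> (\<forall>x. p x = 0 \<longleftrightarrow> x = 0) \<and> (\<forall>x. p (- x) = p x) \<and>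
     (\<forall>x y. p (x + y) \<le> p x + p y)"

definition norm_topology :: "('a::ab_group_add \<Rightarrow> real) \<Rightarrow> 'a topology" where
  "norm_topology p = Metric_space.mtopology UNIV (\<lambda>x y. p (y - x))"

lemma group_normD:
  assumes "group_norm p"
  shows "0 \<le> p x" "p x = 0 \<longleftrightarrow> x = 0" "p (- x) = p x" "p (x + y) \<le> p x + p y"
  using assms by (auto simp: group_norm_def)

lemma group_norm_0: "group_norm p \<Longrightarrow> p 0 = 0"
  by (simp add: group_normD(2))

lemma group_norm_metric:
  assumes p: "group_norm p"
  shows "Metric_space UNIV (\<lambda>x y. p (y - x))"
proof
  show "p (z - x) \<le> p (y - x) + p (z - y)" for x y z
    using group_normD(4) [OF p, of "y - x" "z - y"] by simp
  show "p (y - x) = p (x - y)" for x y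
    using group_normD(3) [OF p, of "x - y"] by simp
  show "p (y - x) = 0 \<longleftrightarrow> x = y" for x y
    using group_normD(2) [OF p, of "y - x"] by auto
qed (simp add: group_normD(1) [OF p])

lemma openin_norm_topology:
  assumes "group_norm p"
  shows "openin (norm_topology p) U \<longleftrightarrow> (\<forall>x\<in>U. \<exists>r>0. \<forall>y. p (y - x) < r \<longrightarrow> y \<in> U)"
proof -
  interpret Metric_space UNIV "\<lambda>x y. p (y - x)" by (rule group_norm_metric [OF assms])
  show ?thesis unfolding norm_topology_def openin_mtopology by (auto simp: subset_iff)
qed

lemma openin_norm_ball:
  assumes p: "group_norm p"
  shows "openin (norm_topology p) {y. p (y - x) < r}"
  unfolding openin_norm_topology [OF p]
proof
  fix y assume y: "y \<in> {y. p (y - x) < r}"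
  have "p (z - x) < r" if "p (z - y) < r - p (y - x)" for z
    using group_normD(4) [OF p, of "z - y" "y - x"] that by simp
  then show "\<exists>s>0. \<forall>z. p (z - y) < s \<longrightarrow> z \<in> {y. p (y - x) < r}"
    using y by (intro exI [of _ "r - p (y - x)"]) auto
qed

lemma norm_topology_group_topology:
  assumes p: "group_norm p"
  shows "group_topology (norm_topology p)"
proof -
  let ?T = "norm_topology p"
  interpret Metric_space UNIV "\<lambda>x y. p (y - x)" by (rule group_norm_metric [OF p])
  have top: "topspace ?T = UNIV" by (simp add: norm_topology_def)
  have "openin (prod_topology ?T ?T) {z. fst z + snd z \<in> U}" if U: "openin ?T U" for U
    unfolding openin_prod_topology_alt
  proof (intro allI impI)
    fix x y assume "(x, y) \<in> {z. fst z + snd z \<in> U}"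
    then obtain r where r: "r > 0" "\<And>z. p (z - (x + y)) < r \<Longrightarrow> z \<in> U"
      using U unfolding openin_norm_topology [OF p] by auto
    define s where "s = r / 2"
    have "a + b \<in> U" if "p (a - x) < s" "p (b - y) < s" for a b
    proof (rule r(2))
      have "a + b - (x + y) = (a - x) + (b - y)" by simp
      then have "p (a + b - (x + y)) \<le> p (a - x) + p (b - y)" using group_normD(4) [OF p] by metis
      then show "p (a + b - (x + y)) < r" using that by (simp add: s_def)
    qed
    then show "\<exists>V W. openin ?T V \<and> openin ?T W \<and> x \<in> V \<and> y \<in> W \<and> V \<times> W \<subseteq> {z. fst z + snd z \<in> U}"
      using r(1) s_def
      by (rule_tac exI [of _ "{z. p (z - x) < s}"], rule_tac exI [of _ "{z. p (z - y) < s}"])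
         (auto simp: openin_norm_ball [OF p] group_norm_0 [OF p])
  qed
  moreover have "openin ?T {z. - z \<in> U}" if U: "openin ?T U" for U
    unfolding openin_norm_topology [OF p]
  proof
    fix x assume "x \<in> {z. - z \<in> U}"
    then obtain r where r: "r > 0" "\<And>z. p (z - (- x)) < r \<Longrightarrow> z \<in> U"
      using U unfolding openin_norm_topology [OF p] by auto
    have "- z \<in> U" if "p (z - x) < r" for z
      using r(2) [of "- z"] group_normD(3) [OF p, of "z - x"] that by simp
    then show "\<exists>s>0. \<forall>z. p (z - x) < s \<longrightarrow> z \<in> {z. - z \<in> U}" using r(1) by auto
  qed
  ultimately show ?thesis
    by (simp add: group_topology_def top continuous_map_def case_prod_unfold)
qed

lemma norm_topology_metrizable: "group_norm p \<Longrightarrow> metrizable_space (norm_topology p)"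
  unfolding norm_topology_def using Metric_space.metrizable_space_mtopology group_norm_metric by blast

lemma dual_group_norm_topologyI:
  assumes p: "group_norm p" and \<phi>: "character \<phi>"
    and "\<And>e. e > 0 \<Longrightarrow> \<exists>d>0. \<forall>x. p x < d \<longrightarrow> cmod (\<phi> x - 1) < e"
  shows "\<phi> \<in> dual_group (norm_topology p)"
proof (rule dual_groupI [OF norm_topology_group_topology [OF p] \<phi>])
  fix e :: real assume "e > 0"
  then obtain d where d: "d > 0" "\<forall>x. p x < d \<longrightarrow> cmod (\<phi> x - 1) < e" using assms(3) by blast
  then show "\<exists>V. openin (norm_topology p) V \<and> 0 \<in> V \<and> (\<forall>x\<in>V. cmod (\<phi> x - 1) < e)"
    using openin_norm_ball [OF p, of 0 d]
    by (intro exI [of _ "{x. p x < d}"]) (simp add: group_norm_0 [OF p])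
qed

lemma dual_group_norm_topologyD:
  assumes p: "group_norm p" and \<phi>: "\<phi> \<in> dual_group (norm_topology p)" and "e > 0"
  obtains d where "d > 0" "\<And>x. p x < d \<Longrightarrow> cmod (\<phi> x - 1) < e"
proof -
  obtain V where V: "openin (norm_topology p) V" "0 \<in> V" "\<And>x. x \<in> V \<Longrightarrow> cmod (\<phi> x - 1) < e"
    using dual_group_continuous_at_0 [OF norm_topology_group_topology [OF p] \<phi> \<open>e > 0\<close>] by metis
  obtain d where "d > 0" "\<forall>y. p (y - 0) < d \<longrightarrow> y \<in> V"
    using V(1,2) unfolding openin_norm_topology [OF p] by blast
  then show ?thesis using that [of d] V(3) by simp
qed

locale separating_characters =
  fixes H :: "'a::ab_group_add set" and \<phi> :: "nat \<Rightarrow> 'a \<Rightarrow> complex"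
  assumes H: "zm.subspace H"
    and char: "\<And>n. character (\<phi> n)"
    and sep: "\<And>x. x \<in> H \<Longrightarrow> (\<And>n. \<phi> n x = 1) \<Longrightarrow> x = 0"
begin

text \<open>Weights 1 give uniform convergence of all \<open>\<phi> n\<close> on \<open>H\<close>;
  weights tending to 0 give pointwise convergence, as all but finitely many terms are then small
  anyway. The value 2 off \<open>H\<close> bounds every weighted term for weights at most 1, which
  saves the triangle inequality and makes \<open>H\<close> open.\<close>

definition sup_norm :: "(nat \<Rightarrow> real) \<Rightarrow> 'a \<Rightarrow> real" where
  "sup_norm w x = (if x \<in> H then SUP n. w n * cmod (\<phi> n x - 1) else 2)"

context
  fixes w :: "nat \<Rightarrow> real"
  assumes w: "\<And>n. 0 < w n" "\<And>n. w n \<le> 1"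
begin

lemma weighted_le_2: "w n * cmod (\<phi> n x - 1) \<le> 2"
proof -
  have "cmod (\<phi> n x - 1) \<le> 2" using norm_triangle_ineq4 [of "\<phi> n x" 1] char by simp
  then have "w n * cmod (\<phi> n x - 1) \<le> 1 * 2"
    using w [of n] by (intro mult_mono) auto
  then show ?thesis by simp
qed

lemma weighted_le_sup_norm: "x \<in> H \<Longrightarrow> w n * cmod (\<phi> n x - 1) \<le> sup_norm w x"
  unfolding sup_norm_def using weighted_le_2
  by (auto intro!: cSUP_upper bdd_aboveI2 [where M = 2])

lemma sup_norm_le: "x \<in> H \<Longrightarrow> (\<And>n. w n * cmod (\<phi> n x - 1) \<le> c) \<Longrightarrow> sup_norm w x \<le> c"
  unfolding sup_norm_def by (auto intro: cSUP_least)

lemma sup_norm_le_2: "sup_norm w x \<le> 2"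
  using sup_norm_le [of x 2] weighted_le_2 by (cases "x \<in> H") (auto simp: sup_norm_def)

lemma sup_norm_less_2: "sup_norm w x < 2 \<Longrightarrow> x \<in> H"
  by (auto simp: sup_norm_def split: if_splits)

lemma sup_norm_group_norm: "group_norm (sup_norm w)"
  unfolding group_norm_def
proof (intro conjI allI)
  show nonneg: "0 \<le> sup_norm w x" for x
  proof (cases "x \<in> H")
    case True
    have "0 \<le> w 0 * cmod (\<phi> 0 x - 1)" using w(1) [of 0] by simp
    then show ?thesis using weighted_le_sup_norm [OF True, of 0] by linarith
  qed (simp add: sup_norm_def)
  show "sup_norm w x = 0 \<longleftrightarrow> x = 0" for x
  proof
    assume 0: "sup_norm w x = 0"
    then have x: "x \<in> H" by (intro sup_norm_less_2) simp
    have "\<phi> n x = 1" for n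
      using weighted_le_sup_norm [OF x, of n] w(1) [of n] 0 by (simp add: mult_le_0_iff)
    then show "x = 0" using sep x by blast
  next
    assume "x = 0"
    then show "sup_norm w x = 0"
      using zm.subspace_0 [OF H] by (simp add: sup_norm_def char)
  qed
  show "sup_norm w (- x) = sup_norm w x" for x
    using zm.subspace_neg [OF H, of x] zm.subspace_neg [OF H, of "- x"]
    by (auto simp: sup_norm_def character_minus [OF char] norm_inverse_minus_1 char)
  show "sup_norm w (x + y) \<le> sup_norm w x + sup_norm w y" for x y
  proof (cases "x \<in> H \<and> y \<in> H")
    case True
    show ?thesis
    proof (rule sup_norm_le)
      show "x + y \<in> H" using True zm.subspace_add [OF H] by blast
      fix n
      have "w n * cmod (\<phi> n (x + y) - 1) \<le> w n * (cmod (\<phi> n x - 1) + cmod (\<phi> n y - 1))"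
        using w(1) [of n]
        by (intro mult_left_mono) (simp_all add: character_add [OF char] norm_mult_minus_1_le char)
      also have "\<dots> \<le> sup_norm w x + sup_norm w y"
        using True weighted_le_sup_norm [of x n] weighted_le_sup_norm [of y n]
        by (simp add: distrib_left)
      finally show "w n * cmod (\<phi> n (x + y) - 1) \<le> sup_norm w x + sup_norm w y" .
    qed
  next
    case False
    then have "sup_norm w x + sup_norm w y \<ge> 2"
      using nonneg [of x] nonneg [of y] by (auto simp: sup_norm_def split: if_splits)
    then show ?thesis using sup_norm_le_2 [of "x + y"] by linarith
  qed
qed

abbreviation (input) "sup_topology \<equiv> norm_topology (sup_norm w)"

lemma sup_topology_open_subgroup: "openin sup_topology H"
proof -
  have "y \<in> H" if "x \<in> H" "sup_norm w (y - x) < 2" for x y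
    using zm.subspace_add [OF H sup_norm_less_2 [OF that(2)] that(1)] by simp
  then show ?thesis
    unfolding openin_norm_topology [OF sup_norm_group_norm] by (intro ballI exI [of _ 2]) auto
qed

lemma sup_topology_character: "\<phi> n \<in> dual_group sup_topology"
proof (rule dual_group_norm_topologyI [OF sup_norm_group_norm char])
  fix e :: real assume e: "e > 0"
  have "cmod (\<phi> n x - 1) < e" if x: "sup_norm w x < min 2 (w n * e)" for x
  proof -
    have "x \<in> H" using x by (intro sup_norm_less_2) simp
    then have "w n * cmod (\<phi> n x - 1) < w n * e" using weighted_le_sup_norm [of x n] x by simp
    then show ?thesis using w(1) [of n] by simp
  qed
  then show "\<exists>d>0. \<forall>x. sup_norm w x < d \<longrightarrow> cmod (\<phi> n x - 1) < e"
    using e w(1) [of n] by (intro exI [of _ "min 2 (w n * e)"]) auto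
qed

text \<open>A point of \<open>H\<close> outside the set is excluded by the power of
  \<open>\<phi> n\<close> whose condition it violates. A point outside \<open>H\<close> is separated
  from \<open>H\<close> by a character trivial on \<open>H\<close>, continuous because
  \<open>H\<close> is open; some power of its value has negative real part, as otherwise the value
  would be arbitrarily close to 1.\<close>

lemma sup_topology_quasi_convex:
  "quasi_convex sup_topology {x \<in> H. \<forall>n j. j \<le> K \<longrightarrow> r \<le> w n \<longrightarrow> Re (\<phi> n x ^ j) \<ge> 0}"
    (is "quasi_convex _ ?M")
  unfolding quasi_convex_def
proof (intro allI impI)
  note gT = norm_topology_group_topology [OF sup_norm_group_norm]
  have circle_plus: "z \<in> circle_plus \<longleftrightarrow> Re z \<ge> 0" if "cmod z = 1" for z
    using that by (simp add: circle_plus_def circle_def)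
  fix x assume x: "x \<notin> ?M"
  show "\<exists>\<psi>\<in>dual_group sup_topology. \<psi> ` ?M \<subseteq> circle_plus \<and> \<psi> x \<notin> circle_plus"
  proof (cases "x \<in> H")
    case True
    then obtain n j where nj: "j \<le> K" "r \<le> w n" "\<not> Re (\<phi> n x ^ j) \<ge> 0" using x by blast
    then show ?thesis
      using dual_group_power [OF gT sup_topology_character, of n j]
      by (intro bexI [of _ "\<lambda>x. \<phi> n x ^ j"]) (auto simp: circle_plus norm_power char)
  next
    case False
    obtain \<psi> where \<psi>: "character \<psi>" "\<And>y. y \<in> H \<Longrightarrow> \<psi> y = 1" "\<psi> x \<noteq> 1"
      using character_separates [OF H False] by blast
    have "\<exists>j. Re (\<psi> x ^ j) < 0"
    proof (rule ccontr)
      assume "\<nexists>j. Re (\<psi> x ^ j) < 0"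
      then have pos: "Re (\<psi> x ^ j) \<ge> 0" for j by (simp add: not_less)
      obtain L where "\<And>z. cmod z = 1 \<Longrightarrow> (\<And>j. j \<le> L \<Longrightarrow> Re (z ^ j) \<ge> 0)
          \<Longrightarrow> cmod (z - 1) \<le> cmod (\<psi> x - 1) / 2"
        using circle_powers_nonneg_imp_small [of "cmod (\<psi> x - 1) / 2"] \<psi>(3) by auto
      from this [OF character_norm [OF \<psi>(1)] pos] \<psi>(3) show False by simp
    qed
    then obtain j where j: "Re (\<psi> x ^ j) < 0" by blast
    have "(\<lambda>y. \<psi> y ^ j) \<in> dual_group sup_topology"
      by (rule dual_group_power [OF gT dual_group_trivial_on_open [OF gT \<psi>(1)
            sup_topology_open_subgroup zm.subspace_0 [OF H] \<psi>(2)]])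
    then show ?thesis
      using j \<psi>(1,2) by (intro bexI [of _ "\<lambda>y. \<psi> y ^ j"]) (auto simp: circle_plus norm_power)
  qed
qed

lemma sup_topology_locally_quasi_convex: "locally_quasi_convex sup_topology"
  unfolding locally_quasi_convex_def
proof (intro conjI allI impI)
  note p = sup_norm_group_norm
  show "group_topology sup_topology" by (rule norm_topology_group_topology [OF p])
  show "Hausdorff_space sup_topology"
    by (rule metrizable_imp_Hausdorff_space [OF norm_topology_metrizable [OF p]])
  fix U assume U: "openin sup_topology U \<and> 0 \<in> U"
  then obtain r where r: "r > 0" "\<And>x. sup_norm w x < r \<Longrightarrow> x \<in> U"
    unfolding openin_norm_topology [OF p] by force
  obtain K where K: "\<And>z. cmod z = 1 \<Longrightarrow> (\<And>j. j \<le> K \<Longrightarrow> Re (z ^ j) \<ge> 0) \<Longrightarrow> cmod (z - 1) \<le> r / 2"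
    using circle_powers_nonneg_imp_small [of "r / 2"] r(1) by auto
  \<comment> \<open>A term of weight below \<open>r / 4\<close> is at most \<open>r / 4 * 2\<close>
    in any case. Only characters of weight at least \<open>r / 4\<close> need control, and
    \<open>K\<close> makes their terms at most \<open>r / 2\<close>.\<close>
  define M where "M = {x \<in> H. \<forall>n j. j \<le> K \<longrightarrow> r / 4 \<le> w n \<longrightarrow> Re (\<phi> n x ^ j) \<ge> 0}"
  \<comment> \<open>The bound 2 puts the ball inside \<open>H\<close>. The other one gives
    \<open>cmod (\<phi> n x - 1) < 1 / Suc K\<close> for weights at least \<open>r / 4\<close>, so
    powers up to \<open>K\<close> stay within 1 of 1.\<close>
  define d where "d = min 2 (r / (4 * real (Suc K)))"
  have d: "d > 0" using r(1) by (simp add: d_def)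
  have "{x. sup_norm w x < d} \<subseteq> M"
  proof
    fix x assume x: "x \<in> {x. sup_norm w x < d}"
    then have xH: "x \<in> H" by (intro sup_norm_less_2) (simp add: d_def)
    have "Re (\<phi> n x ^ j) \<ge> 0" if "j \<le> K" "r / 4 \<le> w n" for n j
    proof -
      have "r / 4 * cmod (\<phi> n x - 1) \<le> w n * cmod (\<phi> n x - 1)"
        using that by (intro mult_right_mono) auto
      also have "\<dots> < r / (4 * real (Suc K))"
        using weighted_le_sup_norm [OF xH, of n] x by (simp add: d_def)
      finally have "r / 4 * cmod (\<phi> n x - 1) < r / 4 * (1 / real (Suc K))" by simp
      then have "cmod (\<phi> n x - 1) < 1 / real (Suc K)"
        using r(1) by (subst (asm) mult_less_cancel_left_pos) auto
      then have "real (Suc K) * cmod (\<phi> n x - 1) < 1"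
        by (simp only: pos_less_divide_eq of_nat_0_less_iff zero_less_Suc mult.commute)
      moreover have "cmod (\<phi> n x ^ j - 1) \<le> real (Suc K) * cmod (\<phi> n x - 1)"
        using norm_power_minus_1_le [OF character_norm [OF char], of n x j] that(1)
        by (elim order_trans) (intro mult_right_mono, auto)
      ultimately have "\<bar>Re (\<phi> n x ^ j - 1)\<bar> < 1" using abs_Re_le_cmod [of "\<phi> n x ^ j - 1"] by linarith
      then show ?thesis by simp
    qed
    then show "x \<in> M" using xH by (simp add: M_def)
  qed
  moreover have "M \<subseteq> U"
  proof
    fix x assume x: "x \<in> M"
    then have xH: "x \<in> H" by (simp add: M_def)
    have "w n * cmod (\<phi> n x - 1) \<le> r / 2" for n
    proof (cases "r / 4 \<le> w n")
      case True
      then have "cmod (\<phi> n x - 1) \<le> r / 2" using x by (intro K) (auto simp: M_def char)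
      then have "w n * cmod (\<phi> n x - 1) \<le> 1 * (r / 2)"
        using w [of n] by (intro mult_mono) auto
      then show ?thesis by simp
    next
      case False
      have "cmod (\<phi> n x - 1) \<le> 2" using norm_triangle_ineq4 [of "\<phi> n x" 1] char by simp
      then have "w n * cmod (\<phi> n x - 1) \<le> r / 4 * 2"
        using w(1) [of n] False r(1) by (intro mult_mono) auto
      then show ?thesis by simp
    qed
    then have "sup_norm w x \<le> r / 2" by (rule sup_norm_le [OF xH])
    then show "x \<in> U" using r by simp
  qed
  moreover have "quasi_convex sup_topology M"
    unfolding M_def by (rule sup_topology_quasi_convex)
  moreover have "openin sup_topology {x. sup_norm w x < d}"
    using openin_norm_ball [OF p, of 0 d] by simp
  moreover have "0 \<in> {x. sup_norm w x < d}" using d by (simp add: group_norm_0 [OF p])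
  ultimately show "\<exists>M V. quasi_convex sup_topology M \<and> openin sup_topology V \<and> 0 \<in> V \<and> V \<subseteq> M \<and> M \<subseteq> U"
    by blast
qed

end

end

section \<open>A criterion for failing the Mackey property\<close>

text \<open>Since \<open>n \<le> 4 * (n div 2) \<le> 2 * n\<close>, the angle lies between pi/2 and
  pi and its cosine is not positive.\<close>

lemma norm_cis_half_turn_minus_1_ge:
  assumes "2 \<le> n"
  shows "1 \<le> cmod (cis (real (n div 2) * (2 * pi / real n)) - 1)"
proof -
  define \<alpha> where "\<alpha> = real (n div 2) * (2 * pi / real n)"
  have 1: "n \<le> 4 * (n div 2)" "2 * (n div 2) \<le> n" using assms by linarith+
  have "pi / 2 \<le> \<alpha>"
    using assms 1(1) by (simp add: \<alpha>_def field_simps flip: of_nat_mult)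
  moreover have "\<alpha> \<le> pi"
    using assms 1(2) by (simp add: \<alpha>_def field_simps flip: of_nat_mult)
  ultimately have "cos \<alpha> \<le> cos (pi / 2)" by (intro cos_monotone_0_pi_le) auto
  then have "1 \<le> \<bar>Re (cis \<alpha> - 1)\<bar>" by simp
  then show ?thesis unfolding \<alpha>_def [symmetric] using abs_Re_le_cmod order_trans by blast
qed

text \<open>A character continuous for the uniform topology sends all small combinations of the \<open>e k\<close> to the
  right half plane, which bounds the sum of \<open>q k * \<bar>Arg (\<psi> (e k))\<bar>\<close>; the last assumption turns this
  into a factorization over finitely many \<open>\<phi> n\<close>. By the assumption before it, the multiples
  \<open>(q k div 2) e k\<close>, which tend to \<open>0\<close> in the weak topology, do not do so in the uniform one.\<close>

locale mackey_gap = separating_characters H \<phi> for H :: "'a::ab_group_add set" and \<phi> +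
  fixes e :: "nat \<Rightarrow> 'a" and q :: "nat \<Rightarrow> nat" and b :: "nat \<Rightarrow> nat \<Rightarrow> real" and C :: real
  assumes H_span: "H = zm.span (range e)"
    and \<phi>_e: "\<And>n k. \<phi> n (e k) = cis (b n k)"
    and q_top: "filterlim q at_top sequentially"
    and b_sum: "\<And>n N. (\<Sum>k<N. real (q k) * \<bar>b n k\<bar>) \<le> C"
    and far: "\<And>k. \<exists>n. b n k = 2 * pi / real (q k)"
    and dual: "\<And>\<psi>. character \<psi> \<Longrightarrow> (\<lambda>k. real (q k) * Arg (\<psi> (e k))) \<longlonglongrightarrow> 0 \<Longrightarrow>
        \<exists>N a. \<forall>k. \<psi> (e k) = (\<Prod>n<N. \<phi> n (e k) powi a n)"
begin

lemma e_in_H: "e k \<in> H"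
  unfolding H_span by (simp add: zm.span_base)

lemma combination_in_H: "(\<Sum>k<N. zmul (s k) (e k)) \<in> H"
  by (intro zm.subspace_sum zm.subspace_scale H e_in_H)

lemma C_nonneg: "0 \<le> C"
  using b_sum [where N = 0] by simp

lemma \<phi>_combination: "\<phi> n (\<Sum>k<N. zmul (s k) (e k)) = cis (\<Sum>k<N. of_int (s k) * b n k)"
  by (induction N)
     (simp_all add: char character_add [OF char] character_zmul [OF char] \<phi>_e cis_power_int cis_mult)

lemma q_large: "eventually (\<lambda>k. c \<le> real (q k)) sequentially"
  using filterlim_compose [OF filterlim_real_sequentially q_top] by (simp add: filterlim_at_top)

abbreviation "uniform_top \<equiv> norm_topology (sup_norm (\<lambda>_. 1))"

abbreviation "weak_top \<equiv> norm_topology (sup_norm (\<lambda>n. 1 / real (Suc n)))"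

text \<open>The bound \<open>C\<close> is uniform in \<open>n\<close>: coefficients of size at most
  \<open>\<epsilon> * q k\<close> let every \<open>\<phi> n\<close> turn the combination by at most
  \<open>\<epsilon> * C\<close>, however many generators occur.\<close>

lemma small_combination:
  assumes d: "0 < d"
  obtains \<epsilon> where "\<epsilon> > 0" "\<And>N s. (\<And>k. real_of_int \<bar>s k\<bar> \<le> \<epsilon> * real (q k)) \<Longrightarrow>
      sup_norm (\<lambda>_. 1) (\<Sum>k<N. zmul (s k) (e k)) < d"
proof -
  \<comment> \<open>The summand 1 makes \<open>\<epsilon> * C < d\<close> strict and covers
    \<open>C = 0\<close>.\<close>
  define \<epsilon> where "\<epsilon> = d / (C + 1)"
  have \<epsilon>: "\<epsilon> > 0" using d C_nonneg by (simp add: \<epsilon>_def)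
  have \<epsilon>C: "\<epsilon> * C < d"
    using d C_nonneg by (simp add: \<epsilon>_def field_simps)
  have "sup_norm (\<lambda>_. 1) (\<Sum>k<N. zmul (s k) (e k)) < d"
    if s: "\<And>k. real_of_int \<bar>s k\<bar> \<le> \<epsilon> * real (q k)" for N s
  proof -
    have "1 * cmod (\<phi> n (\<Sum>k<N. zmul (s k) (e k)) - 1) \<le> \<epsilon> * C" for n
    proof -
      have "cmod (\<phi> n (\<Sum>k<N. zmul (s k) (e k)) - 1) \<le> \<bar>\<Sum>k<N. of_int (s k) * b n k\<bar>"
        unfolding \<phi>_combination by (rule norm_cis_minus_1_le)
      also have "\<dots> \<le> (\<Sum>k<N. \<epsilon> * real (q k) * \<bar>b n k\<bar>)"
        using s by (intro order_trans [OF sum_abs] sum_mono) (auto simp: abs_mult intro!: mult_right_mono)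
      also have "\<dots> \<le> \<epsilon> * C"
        using b_sum [of n N] \<epsilon> by (simp add: mult.assoc flip: sum_distrib_left)
      finally show ?thesis by simp
    qed
    then have "sup_norm (\<lambda>_. 1) (\<Sum>k<N. zmul (s k) (e k)) \<le> \<epsilon> * C"
      by (intro sup_norm_le combination_in_H) auto
    then show ?thesis using \<epsilon>C by simp
  qed
  then show ?thesis using that \<epsilon> by blast
qed

lemma uniform_continuous_arg_tendsto_0:
  assumes "\<psi> \<in> dual_group uniform_top"
  shows "(\<lambda>k. real (q k) * Arg (\<psi> (e k))) \<longlonglongrightarrow> 0"
proof -
  have norm: "group_norm (sup_norm (\<lambda>_. 1))" by (rule sup_norm_group_norm) auto
  note \<psi> = dual_group_character [OF norm_topology_group_topology [OF norm] assms]
  obtain d where d: "d > 0" "\<And>x. sup_norm (\<lambda>_. 1) x < d \<Longrightarrow> cmod (\<psi> x - 1) < 1"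
    using dual_group_norm_topologyD [OF norm assms, of 1] by auto
  obtain \<epsilon> where \<epsilon>: "\<epsilon> > 0" "\<And>N s. (\<And>k. real_of_int \<bar>s k\<bar> \<le> \<epsilon> * real (q k)) \<Longrightarrow>
      sup_norm (\<lambda>_. 1) (\<Sum>k<N. zmul (s k) (e k)) < d"
    using small_combination [OF d(1)] by metis
  define \<theta> where "\<theta> k = Arg (\<psi> (e k))" for k
  \<comment> \<open>The largest number of copies of \<open>e k\<close> that
    \<open>small_combination\<close> allows.\<close>
  define t where "t k = nat \<lfloor>\<epsilon> * real (q k)\<rfloor>" for k
  have cis: "\<psi> (e k) = cis (\<theta> k)" for k
    using cis_Arg [of "\<psi> (e k)"] \<psi> by (simp add: \<theta>_def sgn_div_norm)
  have t: "real (t k) \<le> \<epsilon> * real (q k)" for k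
    using \<epsilon>(1) by (simp add: t_def)
  have cos: "cos (\<Sum>k<N. real (u k) * \<bar>\<theta> k\<bar>) \<ge> 0" if u: "\<And>k. u k \<le> t k" for u N
  proof -
    \<comment> \<open>The signs make all angles turn in the same direction, so that nothing
      cancels.\<close>
    define s where "s k = (if \<theta> k \<ge> 0 then int (u k) else - int (u k))" for k
    have s: "real_of_int \<bar>s k\<bar> \<le> \<epsilon> * real (q k)" for k
      using u [of k] t [of k] by (simp add: s_def)
    have "real_of_int (s k) * \<theta> k = real (u k) * \<bar>\<theta> k\<bar>" for k by (simp add: s_def)
    then have "\<psi> (\<Sum>k<N. zmul (s k) (e k)) = cis (\<Sum>k<N. real (u k) * \<bar>\<theta> k\<bar>)"
      by (induction N) (simp_all add: \<psi> character_add [OF \<psi>] character_zmul [OF \<psi>] cis cis_power_int cis_mult)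
    then have "cmod (cis (\<Sum>k<N. real (u k) * \<bar>\<theta> k\<bar>) - 1) < 1"
      using d(2) [OF \<epsilon>(2) [OF s], of N] by simp
    then have "\<bar>Re (cis (\<Sum>k<N. real (u k) * \<bar>\<theta> k\<bar>) - 1)\<bar> < 1"
      using abs_Re_le_cmod order_le_less_trans by blast
    then show ?thesis by simp
  qed
  have "\<bar>\<theta> k\<bar> \<le> pi" for k
    using Arg_bounded [of "\<psi> (e k)"] by (simp add: \<theta>_def abs_le_iff)
  then have "(\<Sum>k<N. real (t k) * \<bar>\<theta> k\<bar>) \<le> pi / 2" for N
    by (intro angle_sum_le [where t = t] cos) auto
  then have "summable (\<lambda>k. real (t k) * \<bar>\<theta> k\<bar>)"
    by (intro summableI_nonneg_bounded [where x = "pi / 2"]) auto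
  then have "(\<lambda>k. real (t k) * \<bar>\<theta> k\<bar>) \<longlonglongrightarrow> 0" by (rule summable_LIMSEQ_zero)
  then have lim: "(\<lambda>k. 2 / \<epsilon> * (real (t k) * \<bar>\<theta> k\<bar>)) \<longlonglongrightarrow> 0"
    using tendsto_mult_right_zero by blast
  \<comment> \<open>Rounding down costs at most a factor 2 once
    \<open>\<epsilon> * q k \<ge> 2\<close>; so \<open>q k\<close> may be replaced by
    \<open>t k\<close>, for which the weighted angles are summable.\<close>
  have "eventually (\<lambda>k. norm (real (q k) * \<theta> k) \<le> 2 / \<epsilon> * (real (t k) * \<bar>\<theta> k\<bar>)) sequentially"
    using q_large [of "2 / \<epsilon>"]
  proof eventually_elim
    case (elim k)
    then have "2 \<le> \<epsilon> * real (q k)" using \<epsilon>(1) by (simp add: field_simps)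
    then have "\<epsilon> * real (q k) \<le> 2 * real (t k)"
      unfolding t_def by linarith
    then have "real (q k) \<le> 2 / \<epsilon> * real (t k)" using \<epsilon>(1) by (simp add: field_simps)
    then have "real (q k) * \<bar>\<theta> k\<bar> \<le> 2 / \<epsilon> * real (t k) * \<bar>\<theta> k\<bar>" by (rule mult_right_mono) simp
    then show ?case by (simp add: abs_mult)
  qed
  then have "(\<lambda>k. real (q k) * \<theta> k) \<longlonglongrightarrow> 0" by (rule Lim_null_comparison [OF _ lim])
  then show ?thesis by (simp add: \<theta>_def)
qed

lemma weak_norm: "group_norm (sup_norm (\<lambda>n. 1 / real (Suc n)))"
  and uniform_norm: "group_norm (sup_norm (\<lambda>_. 1))"
  by (rule sup_norm_group_norm; simp)+

lemma weak_norm_le_uniform_norm: "sup_norm (\<lambda>n. 1 / real (Suc n)) x \<le> sup_norm (\<lambda>_. 1) x"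
proof (cases "x \<in> H")
  case True
  have "1 / real (Suc n) * cmod (\<phi> n x - 1) \<le> sup_norm (\<lambda>_. 1) x" for n
  proof -
    have "1 / real (Suc n) * cmod (\<phi> n x - 1) \<le> 1 * cmod (\<phi> n x - 1)"
      by (intro mult_right_mono) auto
    then show ?thesis using weighted_le_sup_norm [of "\<lambda>_. 1" x n] True by simp
  qed
  then show ?thesis using True by (intro sup_norm_le) auto
qed (simp add: sup_norm_def)

text \<open>The inclusion into the weak dual has the content: on the generators, hence on
  \<open>H\<close>, a uniformly continuous character equals a finite product of powers of the
  \<open>\<phi> n\<close>, and agreement on the weakly open \<open>H\<close> decides
  continuity.\<close>

lemma dual_eq: "dual_group uniform_top = dual_group weak_top"
proof (intro equalityI subsetI)
  fix \<psi> assume \<psi>: "\<psi> \<in> dual_group weak_top"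
  show "\<psi> \<in> dual_group uniform_top"
  proof (rule dual_group_norm_topologyI [OF uniform_norm])
    show "character \<psi>"
      by (rule dual_group_character [OF norm_topology_group_topology [OF weak_norm] \<psi>])
    show "\<exists>d>0. \<forall>x. sup_norm (\<lambda>_. 1) x < d \<longrightarrow> cmod (\<psi> x - 1) < r" if "r > 0" for r
      using dual_group_norm_topologyD [OF weak_norm \<psi> that] weak_norm_le_uniform_norm by (metis order_le_less_trans)
  qed
next
  fix \<psi> assume \<psi>: "\<psi> \<in> dual_group uniform_top"
  have ch: "character \<psi>"
    by (rule dual_group_character [OF norm_topology_group_topology [OF uniform_norm] \<psi>])
  obtain N a where Na: "\<And>k. \<psi> (e k) = (\<Prod>n<N. \<phi> n (e k) powi a n)"
    using dual [OF ch uniform_continuous_arg_tendsto_0 [OF \<psi>]] by blast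
  define \<psi>' where "\<psi>' x = (\<Prod>n<N. \<phi> n x powi a n)" for x
  have gT: "group_topology weak_top" by (rule norm_topology_group_topology [OF weak_norm])
  have \<psi>': "\<psi>' \<in> dual_group weak_top"
    unfolding \<psi>'_def
    by (intro dual_group_prod dual_group_powi gT sup_topology_character) auto
  have Ho: "openin weak_top H" by (rule sup_topology_open_subgroup) auto
  have ch': "character \<psi>'" by (rule dual_group_character [OF gT \<psi>'])
  have "\<psi> x = \<psi>' x" if "x \<in> H" for x
    using that unfolding H_span
  proof (induction x rule: zm.span_induct)
    case base
    show ?case
      by (auto simp: zm.subspace_def character_add character_zmul ch ch')
  next
    case (step x)
    then show ?case using Na by (auto simp: \<psi>'_def)
  qed
  then show "\<psi> \<in> dual_group weak_top"
    using zm.subspace_0 [OF H]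
    by (intro dual_group_cong_open [OF gT \<psi>' ch Ho]) auto
qed

lemma uniform_top_not_coarser: "\<not> (\<forall>U. openin uniform_top U \<longrightarrow> openin weak_top U)"
proof
  assume "\<forall>U. openin uniform_top U \<longrightarrow> openin weak_top U"
  then have "openin weak_top {x. sup_norm (\<lambda>_. 1) x < 1}"
    using openin_norm_ball [OF uniform_norm, of 0 1] by simp
  moreover have "0 \<in> {x. sup_norm (\<lambda>_. 1) x < 1}" by (simp add: group_norm_0 [OF uniform_norm])
  ultimately obtain r where "r > 0" "\<forall>y. sup_norm (\<lambda>n. 1 / real (Suc n)) (y - 0) < r
      \<longrightarrow> y \<in> {x. sup_norm (\<lambda>_. 1) x < 1}"
    unfolding openin_norm_topology [OF weak_norm] by blast
  then have r: "r > 0"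
    "\<And>x. sup_norm (\<lambda>n. 1 / real (Suc n)) x < r \<Longrightarrow> sup_norm (\<lambda>_. 1) x < 1"
    by simp_all
  \<comment> \<open>For \<open>q k \<ge> 2\<close> the character supplied by \<open>far\<close>
    turns \<open>x k\<close> by an angle between pi/2 and pi. For a fixed \<open>n\<close> the angle
    is at most \<open>q k * |b n k|\<close>, a term of a convergent series.\<close>
  define x where "x k = zmul (int (q k div 2)) (e k)" for k
  have x: "x k \<in> H" for k unfolding x_def by (intro zm.subspace_scale H e_in_H)
  have \<phi>_x: "\<phi> n (x k) = cis (real (q k div 2) * b n k)" for n k
    by (simp add: x_def character_zmul [OF char] \<phi>_e Complex.DeMoivre)
  have lim: "(\<lambda>k. cmod (\<phi> n (x k) - 1)) \<longlonglongrightarrow> 0" for n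
  proof (rule Lim_null_comparison)
    have "summable (\<lambda>k. real (q k) * \<bar>b n k\<bar>)"
      by (intro summableI_nonneg_bounded [where x = C]) (auto simp: b_sum)
    then show "(\<lambda>k. real (q k) * \<bar>b n k\<bar>) \<longlonglongrightarrow> 0" by (rule summable_LIMSEQ_zero)
    have "norm (cmod (\<phi> n (x k) - 1)) \<le> real (q k) * \<bar>b n k\<bar>" for k
    proof -
      have "cmod (\<phi> n (x k) - 1) \<le> \<bar>real (q k div 2) * b n k\<bar>"
        unfolding \<phi>_x by (rule norm_cis_minus_1_le)
      also have "\<dots> \<le> real (q k) * \<bar>b n k\<bar>"
        by (auto simp: abs_mult intro!: mult_right_mono)
      finally show ?thesis by simp
    qed
    then show "eventually (\<lambda>k. norm (cmod (\<phi> n (x k) - 1)) \<le> real (q k) * \<bar>b n k\<bar>) sequentially"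
      by simp
  qed
  \<comment> \<open>From index \<open>L\<close> on the weight alone keeps the term below
    \<open>r / 2\<close>; the finitely many other indices are handled by the limit.\<close>
  obtain L where L: "2 / real (Suc L) < r / 2"
    using reals_Archimedean [of "r / 4"] r(1) by (auto simp: field_simps inverse_eq_divide)
  have "eventually (\<lambda>k. \<forall>n\<in>{..<L}. cmod (\<phi> n (x k) - 1) < r / 2) sequentially"
    using r(1) by (intro eventually_ball_finite ballI order_tendstoD(2) [OF lim]) auto
  then have "eventually (\<lambda>k. (\<forall>n\<in>{..<L}. cmod (\<phi> n (x k) - 1) < r / 2) \<and> 2 \<le> real (q k)) sequentially"
    using q_large by (intro eventually_conj)
  then obtain k where "(\<forall>n\<in>{..<L}. cmod (\<phi> n (x k) - 1) < r / 2) \<and> 2 \<le> real (q k)"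
    by (rule eventually_happens' [OF sequentially_bot, THEN exE])
  then have k: "\<And>n. n < L \<Longrightarrow> cmod (\<phi> n (x k) - 1) < r / 2" "2 \<le> q k"
    by auto
  have "1 / real (Suc n) * cmod (\<phi> n (x k) - 1) \<le> r / 2" for n
  proof (cases "n < L")
    case True
    have "1 / real (Suc n) * cmod (\<phi> n (x k) - 1) \<le> 1 * cmod (\<phi> n (x k) - 1)"
      by (intro mult_right_mono) auto
    then show ?thesis using k(1) [OF True] by linarith
  next
    case False
    have "cmod (\<phi> n (x k) - 1) \<le> 2" using norm_triangle_ineq4 [of "\<phi> n (x k)" 1] char by simp
    then have "1 / real (Suc n) * cmod (\<phi> n (x k) - 1) \<le> 1 / real (Suc L) * 2"
      using False by (intro mult_mono) (auto simp: frac_le)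
    then show ?thesis using L by linarith
  qed
  then have "sup_norm (\<lambda>n. 1 / real (Suc n)) (x k) \<le> r / 2"
    by (intro sup_norm_le x) auto
  then have small: "sup_norm (\<lambda>_. 1) (x k) < 1" using r by simp
  obtain n where n: "b n k = 2 * pi / real (q k)" using far by blast
  have "1 \<le> cmod (\<phi> n (x k) - 1)"
    unfolding \<phi>_x n by (rule norm_cis_half_turn_minus_1_ge [OF k(2)])
  then show False using weighted_le_sup_norm [of "\<lambda>_. 1" "x k" n] x small by simp
qed

theorem metrizable_not_mackey:
  "\<exists>T :: 'a topology. metrizable_space T \<and> locally_quasi_convex T \<and> \<not> mackey T"
proof (intro exI conjI)
  show "metrizable_space weak_top" by (rule norm_topology_metrizable [OF weak_norm])
  show "locally_quasi_convex weak_top" by (rule sup_topology_locally_quasi_convex) auto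
  have "locally_quasi_convex uniform_top" by (rule sup_topology_locally_quasi_convex) auto
  then show "\<not> mackey weak_top"
    using uniform_top_not_coarser dual_eq unfolding mackey_def compatible_def by blast
qed

end

section \<open>Infinite cyclic and quasicyclic subgroups, direct sums\<close>

lemma cis_eq_1_iff_multiple: "cis t = 1 \<longleftrightarrow> (\<exists>k::int. t = 2 * pi * of_int k)"
proof
  assume "cis t = 1"
  then have "cos t = 1" by (metis cis.simps(1) one_complex.simps(1))
  then show "\<exists>k::int. t = 2 * pi * of_int k" by (auto simp: cos_one_2pi_int)
qed auto

lemma cis_fraction_eq_1_iff:
  assumes "n > 0"
  shows "cis (2 * pi * of_int j / real n) = 1 \<longleftrightarrow> int n dvd j"
proof -
  have "2 * pi * of_int j / real n = 2 * pi * of_int k \<longleftrightarrow> j = int n * k" for k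
  proof -
    have "2 * pi * of_int j / real n = 2 * pi * of_int k \<longleftrightarrow> real_of_int j = real_of_int (int n * k)"
      using assms by (simp add: field_simps)
    then show ?thesis by (simp only: of_int_eq_iff)
  qed
  then show ?thesis by (auto simp: cis_eq_1_iff_multiple dvd_def)
qed

lemma cis_root_power_int: "cis (2 * pi / real n) powi j = cis (2 * pi * of_int j / real n)"
  by (simp add: cis_power_int mult.commute)

lemma character_Arg: "character \<psi> \<Longrightarrow> \<psi> x = cis (Arg (\<psi> x))"
  using cis_Arg [of "\<psi> x"] by (simp add: sgn_div_norm)

lemma root_of_unity_eq_cis_powi:
  assumes "n > 0" "z ^ n = 1"
  shows "\<exists>j::int. z = cis (2 * pi / real n) powi j"
proof -
  have "cmod z ^ n = 1" using assms(2) by (metis norm_one norm_power)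
  then have "cmod z = 1" using assms(1) power_eq_imp_eq_base [of "cmod z" n 1] by simp
  then have z: "z = cis (Arg z)" using cis_Arg [of z] by (cases "z = 0") (auto simp: sgn_div_norm)
  then have "cis (real n * Arg z) = 1" using assms(2) by (metis Complex.DeMoivre)
  then obtain j :: int where "real n * Arg z = 2 * pi * of_int j" by (auto simp: cis_eq_1_iff_multiple)
  then have "Arg z = 2 * pi * of_int j / real n" using assms(1) by (simp add: field_simps)
  then show ?thesis using z by (metis cis_root_power_int)
qed

lemma filterlim_nat_ge_ident:
  assumes "\<And>k. k \<le> q k"
  shows "filterlim (q :: nat \<Rightarrow> nat) at_top sequentially"
  by (rule filterlim_at_top_mono [OF filterlim_ident]) (simp add: assms)

text \<open>The infinite cyclic and the quasicyclic case use the same scale, whose quotients tend to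
  infinity.\<close>

lemma scale_facts:
  fixes p :: nat
  assumes p: "p \<ge> 2" and d_def: "d = (\<lambda>k::nat. p ^ (k ^ 2))"
    and q_def: "q = (\<lambda>k::nat. p ^ (2 * k + 1))"
  shows "d (Suc k) = q k * d k" "d k > 0" "2 \<le> q k" "k \<le> q k" "k \<le> d k"
    "2 * d k \<le> d (Suc k)" "m \<le> n \<Longrightarrow> d m dvd d n"
proof -
  \<comment> \<open>The exponents \<open>k ^ 2\<close> have unbounded differences
    \<open>2 * k + 1\<close>, so the quotients are unbounded powers of \<open>p\<close> and
    divisibility is kept.\<close>
  have "Suc k ^ 2 = 2 * k + 1 + k ^ 2" by (simp add: power2_eq_square)
  then show dS: "d (Suc k) = q k * d k" unfolding d_def q_def by (metis power_add)
  show "d k > 0" using p by (simp add: d_def)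
  have exp: "j < p ^ j" for j :: nat
    using p by (simp add: less_le_trans [OF less_exp] power_mono)
  have "p ^ 1 \<le> q k" unfolding q_def using p by (intro power_increasing) auto
  then show q2: "2 \<le> q k" using p by simp
  show "k \<le> q k" using exp [of "2 * k + 1"] by (simp add: q_def)
  have "k \<le> k ^ 2" by (simp add: power2_eq_square)
  then show "k \<le> d k" using exp [of "k ^ 2"] by (simp add: d_def)
  show "2 * d k \<le> d (Suc k)" using q2 by (simp add: dS)
  show "d m dvd d n" if "m \<le> n" unfolding d_def using that by (intro le_imp_power_dvd power_mono) auto
qed

text \<open>On the infinite cyclic group of \<open>x = e 0\<close> the weak topology is the 2-adic
  one: there \<open>\<phi> n\<close> has order \<open>d n\<close> and is trivial on
  \<open>e k\<close> for \<open>k \<ge> n\<close>. Its continuous characters on this group are those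
  of 2-power order.\<close>

lemma infinite_order_not_mackey:
  fixes x :: "'a::ab_group_add"
  assumes x: "\<And>k. zmul k x = 0 \<Longrightarrow> k = 0"
  shows "\<exists>T :: 'a topology. metrizable_space T \<and> locally_quasi_convex T \<and> \<not> mackey T"
proof -
  define d where "d = (\<lambda>k::nat. (2::nat) ^ (k ^ 2))"
  define q where "q = (\<lambda>k::nat. (2::nat) ^ (2 * k + 1))"
  note dq = scale_facts [OF order_refl d_def q_def]
  define e where "e k = zmul (int (d k)) x" for k
  define H where "H = zm.span (range e)"
  have "\<exists>\<phi>. character \<phi> \<and> \<phi> x = cis (2 * pi / d n)" for n
  proof -
    have "cis (2 * pi / d n) powi k = 1" if "zmul k x \<in> {0}" for k
      using x [of k] that by simp
    then show ?thesis
      using character_trivial_on_extend [of "{0}" "cis (2 * pi / d n)" x] by (metis norm_cis zm.subspace_single_0)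
  qed
  then obtain \<phi> where \<phi>: "\<And>n. character (\<phi> n)" "\<And>n. \<phi> n x = cis (2 * pi / d n)" by metis
  define b where "b n k = (if n \<le> k then 0 else 2 * pi * real (d k) / real (d n))" for n k
  have \<phi>x: "\<phi> n (zmul j x) = cis (2 * pi * of_int j / real (d n))" for n j
    by (simp add: character_zmul [OF \<phi>(1)] \<phi>(2) cis_root_power_int)
  have \<phi>e: "\<phi> n (e k) = cis (b n k)" for n k
  proof (cases "n \<le> k")
    case True
    then show ?thesis
      using cis_fraction_eq_1_iff [of "d n" "int (d k)"] dq(7) [of n k] dq(2) by (simp add: e_def \<phi>x b_def)
  qed (simp add: e_def \<phi>x b_def)
  \<comment> \<open>As \<open>d\<close> at least doubles at each step, the last term dominates; this
    is where the bound \<open>4 * pi\<close> comes from.\<close>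
  have sum: "(\<Sum>k<n. real (d (Suc k))) \<le> 2 * real (d n)" for n
  proof (induction n)
    case (Suc n)
    then show ?case using dq(6) [of n] by simp
  qed simp
  have H_mult: "\<exists>j. y = zmul j x" if "y \<in> H" for y
  proof -
    have "range e \<subseteq> zm.span {x}" unfolding e_def by (auto intro: zm.span_scale zm.span_base)
    then have "H \<subseteq> zm.span {x}" unfolding H_def by (intro zm.span_minimal) auto
    then show ?thesis using that by (auto simp: zm.span_singleton)
  qed
  interpret mackey_gap H \<phi> e q b "4 * pi"
  proof
    show "zm.subspace H" by (simp add: H_def)
    show "H = zm.span (range e)" by (rule H_def)
    show "y = 0" if y: "y \<in> H" "\<And>n. \<phi> n y = 1" for y
    proof -
      obtain j where j: "y = zmul j x" using H_mult y by blast
      have "int (d n) dvd j" for n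
        using y(2) [of n] cis_fraction_eq_1_iff [OF dq(2)] by (simp add: j \<phi>x)
      then have "int (d (Suc (nat \<bar>j\<bar>))) dvd j" .
      moreover have "\<bar>j\<bar> < int (d (Suc (nat \<bar>j\<bar>)))" using dq(5) [of "Suc (nat \<bar>j\<bar>)"] by linarith
      ultimately have "j = 0" using zdvd_not_zless [of "\<bar>j\<bar>" "int (d (Suc (nat \<bar>j\<bar>)))"] by auto
      then show ?thesis by (simp add: j)
    qed
    show "filterlim q at_top sequentially" by (rule filterlim_nat_ge_ident [OF dq(4)])
    show "(\<Sum>k<N. real (q k) * \<bar>b n k\<bar>) \<le> 4 * pi" for n N
    proof -
      have "(\<Sum>k<N. real (q k) * \<bar>b n k\<bar>) = (\<Sum>k\<in>{..<N} \<inter> {..<n}. real (q k) * \<bar>b n k\<bar>)"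
        by (intro sum.mono_neutral_right) (auto simp: b_def)
      also have "\<dots> \<le> (\<Sum>k<n. real (q k) * \<bar>b n k\<bar>)" by (intro sum_mono2) auto
      also have "\<dots> = (\<Sum>k<n. 2 * pi / real (d n) * real (d (Suc k)))"
        by (intro sum.cong) (auto simp: b_def dq(1))
      also have "\<dots> \<le> 2 * pi / real (d n) * (2 * real (d n))"
        unfolding sum_distrib_left [symmetric] using sum by (intro mult_left_mono) auto
      also have "\<dots> = 4 * pi" using dq(2) [of n] by simp
      finally show ?thesis .
    qed
    show "\<exists>n. b n k = 2 * pi / real (q k)" for k
      using dq(2) [of k] by (intro exI [of _ "Suc k"]) (simp add: b_def dq(1))
    show "\<exists>N a. \<forall>k. \<psi> (e k) = (\<Prod>n<N. \<phi> n (e k) powi a n)"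
      if \<psi>: "character \<psi>" and lim: "(\<lambda>k. real (q k) * Arg (\<psi> (e k))) \<longlonglongrightarrow> 0" for \<psi>
    proof -
      define \<theta> where "\<theta> k = Arg (\<psi> (e k))" for k
      have "eventually (\<lambda>k. \<bar>real (q k) * \<theta> k\<bar> < pi) sequentially"
        using order_tendstoD(2) [OF tendsto_rabs_zero [OF lim]] unfolding \<theta>_def by simp
      then obtain K where K: "\<And>k. k \<ge> K \<Longrightarrow> \<bar>real (q k) * \<theta> k\<bar> < pi"
        unfolding eventually_sequentially by blast
      \<comment> \<open>Since \<open>q k * \<theta> k\<close> stays strictly between -pi and pi, the
        angle is multiplied without reduction modulo a full turn.\<close>
      have step: "\<theta> (Suc k) = real (q k) * \<theta> k" if "k \<ge> K" for k
      proof -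
        have "e (Suc k) = zmul (int (q k)) (e k)" by (simp add: e_def dq(1))
        then have "\<psi> (e (Suc k)) = \<psi> (e k) ^ q k" by (simp add: character_zmul [OF \<psi>])
        also have "\<dots> = cis (real (q k) * \<theta> k)"
          by (subst character_Arg [OF \<psi>]) (simp add: \<theta>_def Complex.DeMoivre)
        finally show ?thesis using K [OF that] by (simp add: \<theta>_def Arg_cis abs_less_iff)
      qed
      \<comment> \<open>From \<open>K\<close> on the angles do not decrease in absolute value, yet
        they tend to 0. So \<open>\<psi>\<close> is trivial on \<open>e K\<close>, and
        \<open>\<psi> x\<close> is a \<open>d K\<close>-th root of unity.\<close>
      have "\<bar>\<theta> K\<bar> \<le> \<bar>\<theta> k\<bar>" if "k \<ge> K" for k
        using that
      proof (induction k rule: dec_induct)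
        case (step k)
        have "1 * \<bar>\<theta> k\<bar> \<le> real (q k) * \<bar>\<theta> k\<bar>" using dq(3) [of k] by (intro mult_right_mono) auto
        then show ?case using step \<open>\<And>k. k \<ge> K \<Longrightarrow> \<theta> (Suc k) = real (q k) * \<theta> k\<close> by (simp add: abs_mult)
      qed simp
      moreover have "(\<lambda>k. \<bar>\<theta> k\<bar>) \<longlonglongrightarrow> 0"
      proof (rule Lim_null_comparison [OF _ tendsto_rabs_zero [OF lim]])
        have "norm \<bar>\<theta> k\<bar> \<le> \<bar>real (q k) * Arg (\<psi> (e k))\<bar>" for k
          using mult_right_mono [of 1 "real (q k)" "\<bar>\<theta> k\<bar>"] dq(3) [of k] by (simp add: \<theta>_def abs_mult)
        then show "eventually (\<lambda>k. norm \<bar>\<theta> k\<bar> \<le> \<bar>real (q k) * Arg (\<psi> (e k))\<bar>) sequentially" by simp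
      qed
      ultimately have "\<bar>\<theta> K\<bar> \<le> 0"
        by (intro tendsto_lowerbound [where F = sequentially]) (auto simp: eventually_sequentially)
      then have "\<psi> (e K) = 1" using character_Arg [OF \<psi>, of "e K"] by (simp add: \<theta>_def)
      then have "\<psi> x ^ d K = 1" by (simp add: e_def character_zmul [OF \<psi>])
      then obtain a :: int where a: "\<psi> x = \<phi> K x powi a"
        using root_of_unity_eq_cis_powi [OF dq(2)] by (auto simp: \<phi>(2))
      have "\<psi> (e k) = (\<Prod>n<Suc K. \<phi> n (e k) powi (if n = K then a else 0))" for k
      proof -
        have "\<psi> (e k) = \<phi> K (e k) powi a"
          by (simp add: e_def character_zmul [OF \<psi>] character_zmul [OF \<phi>(1)] a mult.commute flip: power_int_mult power_int_of_nat)
        moreover have "(\<Prod>n<K. \<phi> n (e k) powi (if n = K then a else 0)) = 1"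
          by (intro prod.neutral) auto
        ultimately show ?thesis by simp
      qed
      then show ?thesis by (intro exI [of _ "Suc K"] exI [of _ "\<lambda>n. if n = K then a else 0"]) blast
    qed
  qed (use \<phi>(1) \<phi>e in auto)
  show ?thesis by (rule metrizable_not_mackey)
qed

text \<open>The character \<open>\<eta>\<close> built here embeds the union \<open>H\<close> of the
  cyclic groups of the \<open>e k\<close> into the circle. All \<open>\<phi> n\<close> are powers of
  \<open>\<phi> 0 = \<eta>\<close>, so on \<open>H\<close> the weak topology is induced from the
  circle, and its continuous characters are the powers of \<open>\<eta>\<close>.\<close>

lemma quasicyclic_not_mackey:
  fixes e :: "nat \<Rightarrow> 'a::ab_group_add"
  assumes p: "p \<ge> 2"
    and order: "\<And>j k. zmul j (e k) = 0 \<longleftrightarrow> int (p ^ (Suc k ^ 2)) dvd j"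
    and tower: "\<And>k. zmul (int (p ^ (2 * Suc k + 1))) (e (Suc k)) = e k"
  shows "\<exists>T :: 'a topology. metrizable_space T \<and> locally_quasi_convex T \<and> \<not> mackey T"
proof -
  define d where "d = (\<lambda>k::nat. p ^ (k ^ 2))"
  define q where "q = (\<lambda>k::nat. p ^ (2 * k + 1))"
  note dq = scale_facts [OF p d_def q_def]
  have order': "zmul j (e k) = 0 \<longleftrightarrow> int (d (Suc k)) dvd j" for j k
    using order by (simp add: d_def)
  have tower': "e k = zmul (int (q (Suc k))) (e (Suc k))" for k
    using tower by (simp add: q_def)
  define H where "H = zm.span (range e)"
  \<comment> \<open>Graph of the embedding of the cyclic group of \<open>e l\<close>. By the tower
    relation each graph extends the previous one, so their union is a partial character.\<close>
  define R where "R l = {(zmul j (e l), cis (2 * pi * of_int j / real (d (Suc l)))) | j. True}" for l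
  have RI: "(zmul j (e l), cis (2 * pi * of_int j / real (d (Suc l)))) \<in> R l" for j l
    unfolding R_def by blast
  have R: "partial_character (R l)" for l
    unfolding partial_character_def
  proof (intro conjI allI impI)
    show "(0, 1) \<in> R l" using RI [of 0 l] by simp
    show "a = 1" if a: "(0, a) \<in> R l" for a
    proof -
      obtain j where "0 = zmul j (e l)" "a = cis (2 * pi * of_int j / real (d (Suc l)))"
        using a unfolding R_def by blast
      then show ?thesis using order' [of j l] cis_fraction_eq_1_iff [OF dq(2)] by simp
    qed
    show "(y - z, a / c) \<in> R l" if yz: "(y, a) \<in> R l" "(z, c) \<in> R l" for y a z c
    proof -
      obtain i j where "y = zmul i (e l)" "a = cis (2 * pi * of_int i / real (d (Suc l)))"
        "z = zmul j (e l)" "c = cis (2 * pi * of_int j / real (d (Suc l)))"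
        using yz unfolding R_def by blast
      then show ?thesis
        using RI [of "i - j" l]
        by (simp add: zmul_diff_left cis_divide right_diff_distrib diff_divide_distrib)
    qed
  qed (auto simp: R_def)
  have "R l \<subseteq> R (Suc l)" for l
  proof -
    have "(zmul j (e l), cis (2 * pi * of_int j / real (d (Suc l)))) \<in> R (Suc l)" for j
    proof -
      have "q (Suc l) > 0" using dq(3) [of "Suc l"] by simp
      then have "2 * pi * of_int j / real (d (Suc l))
          = 2 * pi * of_int (j * int (q (Suc l))) / real (d (Suc (Suc l)))"
        by (simp add: dq(1) [of "Suc l"])
      then show ?thesis using RI [of "j * int (q (Suc l))" "Suc l"] by (simp add: tower' [of l])
    qed
    then show ?thesis unfolding R_def by blast
  qed
  then have R_mono: "R l \<subseteq> R m" if "l \<le> m" for l m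
    using lift_Suc_mono_le [of R] that by blast
  have "subset.chain (Collect partial_character) (range R)"
    unfolding subset_chain_def using R R_mono by (auto, meson nat_le_linear subsetD)
  then have "partial_character (\<Union>(range R))" by (intro partial_character_Union) auto
  then obtain \<eta> where \<eta>: "character \<eta>" "\<And>y a. (y, a) \<in> \<Union>(range R) \<Longrightarrow> \<eta> y = a"
    using partial_character_extend by blast
  have \<eta>e: "\<eta> (zmul j (e k)) = cis (2 * pi * of_int j / real (d (Suc k)))" for j k
    using \<eta>(2) RI [of j k] by blast
  \<comment> \<open>High powers kill the early generators: \<open>\<phi> n (e k) = 1\<close> for
    \<open>k < n\<close>, as \<open>d (Suc k)\<close> divides \<open>d n\<close>. In the infinite
    cyclic case the late generators are killed instead.\<close>
  define \<phi> where "\<phi> n y = \<eta> y powi int (d n)" for n y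
  define b where "b n k = (if k < n then 0 else 2 * pi * real (d n) / real (d (Suc k)))" for n k
  have \<phi>e: "\<phi> n (e k) = cis (b n k)" for n k
  proof -
    have *: "\<phi> n (e k) = cis (2 * pi * of_int (int (d n)) / real (d (Suc k)))"
      using \<eta>e [of "int (d n)" k] by (simp add: \<phi>_def character_zmul [OF \<eta>(1)])
    show ?thesis
    proof (cases "k < n")
      case True
      then show ?thesis
        unfolding * using cis_fraction_eq_1_iff [of "d (Suc k)" "int (d n)"] dq(2) dq(7) [of "Suc k" n]
        by (simp add: b_def)
    qed (simp add: * b_def)
  qed
  \<comment> \<open>The extra summand closes the induction, because
    \<open>1 / d N + 2 / d (Suc N) \<le> 2 / d N\<close>.\<close>
  have sum: "(\<Sum>k\<in>{n..<N}. 1 / real (d k)) + 2 / real (d N) \<le> 2 / real (d n)" if "n \<le> N" for n N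
    using that
  proof (induction N rule: dec_induct)
    case (step N)
    have "2 / real (d (Suc N)) \<le> 2 / (2 * real (d N))"
      using dq(6) [of N] dq(2) [of N] by (intro divide_left_mono) (simp_all flip: of_nat_mult)
    then show ?case using step by simp
  qed simp
  have e_stage: "\<exists>j. e k = zmul j (e l)" if "k \<le> l" for k l
    using that
  proof (induction l rule: dec_induct)
    case base
    show ?case by (intro exI [of _ 1]) simp
  next
    case (step l)
    then obtain j where "e k = zmul j (e l)" by blast
    then show ?case by (subst (asm) tower') auto
  qed
  have H_mult: "\<exists>j k. y = zmul j (e k)" if "y \<in> H" for y
    using that unfolding H_def
  proof (induction y rule: zm.span_induct)
    case base
    show ?case
      unfolding zm.subspace_def
    proof (intro conjI ballI allI)
      show "0 \<in> {y. \<exists>j k. y = zmul j (e k)}" by (auto intro: exI [of _ 0])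
      show "zmul c y \<in> {y. \<exists>j k. y = zmul j (e k)}" if y: "y \<in> {y. \<exists>j k. y = zmul j (e k)}" for c y
      proof -
        obtain j k where "y = zmul j (e k)" using y by blast
        then have "zmul c y = zmul (c * j) (e k)" by simp
        then show ?thesis by blast
      qed
      fix y z assume "y \<in> {y. \<exists>j k. y = zmul j (e k)}" "z \<in> {y. \<exists>j k. y = zmul j (e k)}"
      then obtain i j k l where "y = zmul i (e k)" "z = zmul j (e l)" by blast
      moreover obtain i' j' where "e k = zmul i' (e (max k l))" "e l = zmul j' (e (max k l))"
        using e_stage [of k "max k l"] e_stage [of l "max k l"] by auto
      ultimately have "y + z = zmul (i * i' + j * j') (e (max k l))" by (simp add: zmul_add_left)
      then show "y + z \<in> {y. \<exists>j k. y = zmul j (e k)}" by blast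
    qed
  next
    case (step y)
    then obtain k where "y = e k" by blast
    then show ?case by (metis zmul_1)
  qed
  interpret mackey_gap H \<phi> e q b "4 * pi"
  proof
    show "zm.subspace H" by (simp add: H_def)
    show "H = zm.span (range e)" by (rule H_def)
    show "character (\<phi> n)" for n unfolding \<phi>_def by (rule character_powi [OF \<eta>(1)])
    show "y = 0" if y: "y \<in> H" "\<And>n. \<phi> n y = 1" for y
    proof -
      obtain j k where j: "y = zmul j (e k)" using H_mult y by blast
      have "\<eta> y = 1" using y(2) [of 0] by (simp add: \<phi>_def d_def)
      then have "int (d (Suc k)) dvd j" using cis_fraction_eq_1_iff [OF dq(2)] by (simp add: j \<eta>e)
      then show ?thesis by (simp add: j order')
    qed
    show "filterlim q at_top sequentially" by (rule filterlim_nat_ge_ident [OF dq(4)])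
    show "(\<Sum>k<N. real (q k) * \<bar>b n k\<bar>) \<le> 4 * pi" for n N
    proof (cases "n \<le> N")
      case True
      have "(\<Sum>k<N. real (q k) * \<bar>b n k\<bar>) = (\<Sum>k\<in>{n..<N}. real (q k) * \<bar>b n k\<bar>)"
        by (intro sum.mono_neutral_right) (auto simp: b_def)
      also have "\<dots> = (\<Sum>k\<in>{n..<N}. 2 * pi * real (d n) * (1 / real (d k)))"
      proof (rule sum.cong)
        fix k assume "k \<in> {n..<N}"
        moreover have "q k > 0" using dq(3) [of k] by simp
        ultimately show "real (q k) * \<bar>b n k\<bar> = 2 * pi * real (d n) * (1 / real (d k))"
          by (simp add: b_def dq(1))
      qed simp
      also have "\<dots> \<le> 2 * pi * real (d n) * (2 / real (d n))"
        unfolding sum_distrib_left [symmetric]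
        using sum [OF True] by (intro mult_left_mono) (auto intro: order_trans [rotated])
      also have "\<dots> = 4 * pi" using dq(2) [of n] by simp
      finally show ?thesis .
    next
      case False
      then have "(\<Sum>k<N. real (q k) * \<bar>b n k\<bar>) = 0" by (intro sum.neutral) (auto simp: b_def)
      then show ?thesis by simp
    qed
    show "\<exists>n. b n k = 2 * pi / real (q k)" for k
      using dq(2) [of k] by (intro exI [of _ k]) (simp add: b_def dq(1))
    show "\<exists>N a. \<forall>k. \<psi> (e k) = (\<Prod>n<N. \<phi> n (e k) powi a n)"
      if \<psi>: "character \<psi>" and lim: "(\<lambda>k. real (q k) * Arg (\<psi> (e k))) \<longlonglongrightarrow> 0" for \<psi>
    proof -
      define \<theta> where "\<theta> k = Arg (\<psi> (e k))" for k
      have "eventually (\<lambda>k. \<bar>real (q k) * \<theta> k\<bar> < pi) sequentially"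
        using order_tendstoD(2) [OF tendsto_rabs_zero [OF lim]] unfolding \<theta>_def by simp
      then obtain K where K: "\<And>k. k \<ge> K \<Longrightarrow> \<bar>real (q k) * \<theta> k\<bar> < pi"
        unfolding eventually_sequentially by blast
      have step: "\<theta> k = real (q (Suc k)) * \<theta> (Suc k)" if "k \<ge> K" for k
      proof -
        have "\<psi> (e k) = \<psi> (e (Suc k)) ^ q (Suc k)"
          by (subst tower') (simp add: character_zmul [OF \<psi>])
        also have "\<dots> = cis (real (q (Suc k)) * \<theta> (Suc k))"
          by (subst character_Arg [OF \<psi>]) (simp add: \<theta>_def Complex.DeMoivre)
        finally show ?thesis using K [of "Suc k"] that by (simp add: \<theta>_def Arg_cis abs_less_iff)
      qed
      have "zmul (int (d (Suc K))) (e K) = 0" by (simp add: order')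
      then have "\<psi> (e K) ^ d (Suc K) = 1"
        using character_zmul [OF \<psi>, of "int (d (Suc K))" "e K"] \<psi> by simp
      then have "cis (real (d (Suc K)) * \<theta> K) = 1"
        unfolding \<theta>_def by (metis Complex.DeMoivre character_Arg [OF \<psi>])
      then obtain a :: int where a: "real (d (Suc K)) * \<theta> K = 2 * pi * of_int a"
        by (auto simp: cis_eq_1_iff_multiple)
      \<comment> \<open>Along the tower the angle shrinks exactly as \<open>d (Suc k)\<close> grows,
        so one integer \<open>a\<close> serves all \<open>k \<ge> K\<close>; it becomes the exponent
        of \<open>\<eta>\<close>.\<close>
      have const: "real (d (Suc k)) * \<theta> k = 2 * pi * of_int a" if "k \<ge> K" for k
        using that
      proof (induction k rule: dec_induct)
        case base
        then show ?case by (rule a)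
      next
        case (step k)
        then show ?case using \<open>\<And>k. k \<ge> K \<Longrightarrow> \<theta> k = real (q (Suc k)) * \<theta> (Suc k)\<close> [of k]
          by (simp add: dq(1) [of "Suc k"] mult_ac)
      qed
      have large: "\<psi> (e k) = \<eta> (e k) powi a" if "k \<ge> K" for k
      proof -
        have "\<theta> k = 2 * pi * of_int a / real (d (Suc k))"
          using const [OF that] dq(2) [of "Suc k"] by (simp add: field_simps)
        then have "\<psi> (e k) = \<eta> (zmul a (e k))"
          using character_Arg [OF \<psi>, of "e k"] by (simp add: \<eta>e \<theta>_def)
        then show ?thesis by (simp add: character_zmul [OF \<eta>(1)])
      qed
      have "\<psi> (e k) = \<eta> (e k) powi a" for k
      proof (cases "k \<le> K")
        case True
        then obtain j where "e k = zmul j (e K)" using e_stage by blast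
        then show ?thesis using large [of K]
          by (simp add: character_zmul [OF \<psi>] character_zmul [OF \<eta>(1)] mult.commute flip: power_int_mult)
      qed (use large in simp)
      then have "\<forall>k. \<psi> (e k) = (\<Prod>n<1. \<phi> n (e k) powi a)" by (simp add: \<phi>_def d_def)
      then show ?thesis by (intro exI [of _ 1] exI [of _ "\<lambda>_. a"])
    qed
  qed (use \<phi>e in auto)
  show ?thesis by (rule metrizable_not_mackey)
qed

lemma span_image_finite_stage:
  fixes e :: "nat \<Rightarrow> 'a::ab_group_add"
  assumes "y \<in> zm.span (e ` A)"
  shows "\<exists>N. y \<in> zm.span (e ` (A \<inter> {..<N}))"
  using assms
proof (induction y rule: zm.span_induct)
  case base
  let ?S = "\<lambda>N. zm.span (e ` (A \<inter> {..<N}))"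
  have mono: "?S m \<subseteq> ?S n" if "m \<le> n" for m n :: nat
    by (intro zm.span_mono image_mono) (use that in auto)
  show ?case
    unfolding zm.subspace_def
  proof (intro conjI ballI allI)
    show "0 \<in> {y. \<exists>N. y \<in> ?S N}" using zm.span_zero by blast
    show "zmul c y \<in> {y. \<exists>N. y \<in> ?S N}" if "y \<in> {y. \<exists>N. y \<in> ?S N}" for c y
      using that zm.span_scale by blast
    fix y z assume "y \<in> {y. \<exists>N. y \<in> ?S N}" "z \<in> {y. \<exists>N. y \<in> ?S N}"
    then obtain m n where "y \<in> ?S m" "z \<in> ?S n" by blast
    then have "y \<in> ?S (max m n)" "z \<in> ?S (max m n)"
      using mono [of m "max m n"] mono [of n "max m n"] by auto
    then have "y + z \<in> ?S (max m n)" by (rule zm.span_add)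
    then show "y + z \<in> {y. \<exists>N. y \<in> ?S N}" by blast
  qed
next
  case (step y)
  then obtain k where k: "k \<in> A" "y = e k" by blast
  then have "y \<in> zm.span (e ` (A \<inter> {..<Suc k}))" by (intro zm.span_base) auto
  then show ?case by blast
qed

text \<open>Here \<open>\<phi> n\<close> is the coordinate at \<open>e n\<close>, and on
  \<open>H\<close> the weak topology is induced from the product of the finite cyclic groups. A
  value \<open>\<psi> (e k)\<close> is an \<open>m k\<close>-th root of unity, so
  \<open>m k * Arg (\<psi> (e k))\<close> is a multiple of a full turn and, tending to 0, vanishes
  for large \<open>k\<close>.\<close>

lemma direct_sum_not_mackey:
  fixes e :: "nat \<Rightarrow> 'a::ab_group_add"
  assumes order: "\<And>j n. zmul j (e n) = 0 \<longleftrightarrow> int (m n) dvd j"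
    and large: "\<And>n. n < m n"
    and indep: "\<And>j n. zmul j (e n) \<in> zm.span (e ` {..<n}) \<Longrightarrow> zmul j (e n) = 0"
  shows "\<exists>T :: 'a topology. metrizable_space T \<and> locally_quasi_convex T \<and> \<not> mackey T"
proof -
  have m0: "m n > 0" for n using large [of n] by simp
  define H where "H = zm.span (range e)"
  define S where "S n = zm.span (e ` (- {n}))" for n
  have insert: "\<exists>t i. t \<in> zm.span (e ` B) \<and> y = t + zmul i (e N)"
    if y: "y \<in> zm.span (e ` (insert N B))" for y N B
  proof -
    obtain i where "y - zmul i (e N) \<in> zm.span (e ` B)"
      using y zm.span_breakdown_eq [of y "e N" "e ` B"] by auto
    then show ?thesis by (intro exI [of _ "y - zmul i (e N)"] exI [of _ i]) simp
  qed
  \<comment> \<open>Independence is given from preceding generators only. A later generator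
    \<open>e N\<close> drops out because its multiple would lie in the span of those before
    it.\<close>
  have indep': "zmul j (e n) = 0" if "zmul j (e n) \<in> zm.span (e ` (- {n} \<inter> {..<N}))" for j n N
    using that
  proof (induction N)
    case 0
    then show ?case by simp
  next
    case (Suc N)
    let ?y = "zmul j (e n)"
    consider "N = n" | "N < n" | "N > n" by linarith
    then show ?case
    proof cases
      case 1
      then have "- {n} \<inter> {..<Suc N} = - {n} \<inter> {..<N}" by (auto simp: less_Suc_eq)
      then show ?thesis using Suc by metis
    next
      case 2
      then have "e ` (- {n} \<inter> {..<Suc N}) \<subseteq> e ` {..<n}" by auto
      then show ?thesis using indep Suc(2) zm.span_mono by blast
    next
      case 3
      then have "- {n} \<inter> {..<Suc N} = insert N (- {n} \<inter> {..<N})" by auto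
      then obtain t i where t: "t \<in> zm.span (e ` (- {n} \<inter> {..<N}))" "?y = t + zmul i (e N)"
        using insert Suc(2) by metis
      have "t \<in> zm.span (e ` {..<N})" using t(1) zm.span_mono [of "e ` (- {n} \<inter> {..<N})" "e ` {..<N}"] by blast
      moreover have "?y \<in> zm.span (e ` {..<N})" using 3 by (intro zm.span_scale zm.span_base) auto
      ultimately have "?y - t \<in> zm.span (e ` {..<N})" by (rule zm.span_diff [rotated])
      then have "zmul i (e N) = 0" using indep [of i N] t(2) by simp
      then show ?thesis using Suc(1) t by simp
    qed
  qed
  have "\<exists>\<phi>. character \<phi> \<and> (\<forall>y\<in>S n. \<phi> y = 1) \<and> \<phi> (e n) = cis (2 * pi / m n)" for n
  proof -
    have rel: "cis (2 * pi / m n) powi k = 1" if "zmul k (e n) \<in> S n" for k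
    proof -
      have "zmul k (e n) = 0"
        using span_image_finite_stage [OF that [unfolded S_def]] indep' by blast
      then show ?thesis using cis_fraction_eq_1_iff [OF m0] by (simp add: order cis_root_power_int)
    qed
    have S: "zm.subspace (S n)" by (simp add: S_def)
    show ?thesis
      by (rule character_trivial_on_extend [OF S norm_cis rel]) auto
  qed
  then obtain \<phi> where \<phi>: "\<And>n. character (\<phi> n)" "\<And>n y. y \<in> S n \<Longrightarrow> \<phi> n y = 1"
    "\<And>n. \<phi> n (e n) = cis (2 * pi / m n)" by metis
  have \<phi>_other: "\<phi> n (e k) = 1" if "n \<noteq> k" for n k
    using that by (intro \<phi>(2)) (auto simp: S_def intro: zm.span_base)
  define b where "b n k = (if n = k then 2 * pi / real (m k) else 0)" for n k
  interpret mackey_gap H \<phi> e m b "2 * pi"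
  proof
    show "zm.subspace H" by (simp add: H_def)
    show "H = zm.span (range e)" by (rule H_def)
    show "\<phi> n (e k) = cis (b n k)" for n k by (simp add: b_def \<phi>(3) \<phi>_other)
    show "y = 0" if "y \<in> H" and triv: "\<And>n. \<phi> n y = 1" for y
    proof -
      obtain N where "y \<in> zm.span (e ` {..<N})"
        using span_image_finite_stage [of y e UNIV] \<open>y \<in> H\<close> by (auto simp: H_def)
      then show ?thesis
      proof (induction N)
        case (Suc N)
        obtain t i where t: "t \<in> zm.span (e ` {..<N})" "y = t + zmul i (e N)"
          using insert Suc(2) unfolding lessThan_Suc by blast
        have "e ` {..<N} \<subseteq> e ` (- {N})" by auto
        then have "t \<in> S N" using t(1) zm.span_mono unfolding S_def by blast
        then have "cis (2 * pi * of_int i / real (m N)) = 1"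
          using triv [of N] by (simp add: t(2) character_add [OF \<phi>(1)] character_zmul [OF \<phi>(1)] \<phi>(2,3) cis_root_power_int)
        then have "zmul i (e N) = 0" using cis_fraction_eq_1_iff [OF m0] by (simp add: order)
        then show ?case using Suc(1) t by simp
      qed simp
    qed
    show "filterlim m at_top sequentially"
      by (rule filterlim_nat_ge_ident) (use large less_imp_le in blast)
    show "(\<Sum>k<N. real (m k) * \<bar>b n k\<bar>) \<le> 2 * pi" for n N
    proof -
      have "(\<Sum>k<N. real (m k) * \<bar>b n k\<bar>) = (\<Sum>k<N. if n = k then 2 * pi else 0)"
        using m0 by (intro sum.cong) (auto simp: b_def)
      then show ?thesis by simp
    qed
    show "\<exists>n. b n k = 2 * pi / real (m k)" for k by (intro exI [of _ k]) (simp add: b_def)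
    show "\<exists>N a. \<forall>k. \<psi> (e k) = (\<Prod>n<N. \<phi> n (e k) powi a n)"
      if \<psi>: "character \<psi>" and lim: "(\<lambda>k. real (m k) * Arg (\<psi> (e k))) \<longlonglongrightarrow> 0" for \<psi>
    proof -
      have root: "\<psi> (e k) ^ m k = 1" for k
        using character_zmul [OF \<psi>, of "int (m k)" "e k"] order [of "int (m k)" k] \<psi> by simp
      have "eventually (\<lambda>k. \<bar>real (m k) * Arg (\<psi> (e k))\<bar> < 2 * pi) sequentially"
        using order_tendstoD(2) [OF tendsto_rabs_zero [OF lim]] by simp
      then obtain N where N: "\<And>k. k \<ge> N \<Longrightarrow> \<bar>real (m k) * Arg (\<psi> (e k))\<bar> < 2 * pi"
        unfolding eventually_sequentially by blast
      have triv: "\<psi> (e k) = 1" if "k \<ge> N" for k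
      proof -
        have "cis (real (m k) * Arg (\<psi> (e k))) = 1"
          using root [of k] by (metis Complex.DeMoivre character_Arg [OF \<psi>])
        then obtain a :: int where a: "real (m k) * Arg (\<psi> (e k)) = 2 * pi * of_int a"
          by (auto simp: cis_eq_1_iff_multiple)
        then have "2 * pi * \<bar>real_of_int a\<bar> < 2 * pi * 1" using N [OF that] by (simp add: abs_mult)
        then have "\<bar>real_of_int a\<bar> < 1" by (subst (asm) mult_less_cancel_left_pos) auto
        then have "a = 0" by linarith
        then have "Arg (\<psi> (e k)) = 0" using a m0 [of k] by simp
        then show ?thesis using character_Arg [OF \<psi>, of "e k"] by simp
      qed
      have "\<exists>j. \<psi> (e k) = \<phi> k (e k) powi j" for k
        using root_of_unity_eq_cis_powi [OF m0 root] by (simp add: \<phi>(3))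
      then obtain a where a: "\<And>k. \<psi> (e k) = \<phi> k (e k) powi a k" by metis
      have "\<psi> (e k) = (\<Prod>n<N. \<phi> n (e k) powi a n)" for k
      proof -
        have "(\<Prod>n<N. \<phi> n (e k) powi a n) = (\<Prod>n<N. if n = k then \<psi> (e k) else 1)"
          by (intro prod.cong) (auto simp: a [symmetric] \<phi>_other)
        then show ?thesis using triv [of k] by (simp add: not_less)
      qed
      then show ?thesis by blast
    qed
  qed (rule \<phi>(1))
  show ?thesis by (rule metrizable_not_mackey)
qed

section \<open>The structure of unbounded groups\<close>

text \<open>Meaningful for torsion elements only, where it is the generator in
  \<open>least_multiple_dvd\<close> for \<open>S = {0}\<close>.\<close>

definition torsion_order :: "'a::ab_group_add \<Rightarrow> nat" where
  "torsion_order x = (LEAST n::nat. n > 0 \<and> zmul (int n) x = 0)"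

lemma torsion_order:
  assumes "k \<noteq> 0" "zmul k x = 0"
  shows "torsion_order x > 0" "zmul j x = 0 \<longleftrightarrow> int (torsion_order x) dvd j"
proof -
  note * = least_multiple_dvd [of "{0}" "torsion_order x" x k, unfolded torsion_order_def, simplified]
  show "torsion_order x > 0" unfolding torsion_order_def by (rule *(1)) (use assms in auto)
  have "zmul (int (torsion_order x)) x = 0"
    unfolding torsion_order_def by (rule *(2)) (use assms in auto)
  then have "zmul j x = 0" if "int (torsion_order x) dvd j"
    using that by (auto elim!: dvdE simp: mult.commute [of "int (torsion_order x)"] simp flip: zm.scale_scale)
  moreover have "int (torsion_order x) dvd j" if "zmul j x = 0"
    unfolding torsion_order_def by (rule *(3)) (use assms that in auto)
  ultimately show "zmul j x = 0 \<longleftrightarrow> int (torsion_order x) dvd j" by blast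
qed

text \<open>By Bezout the gcd of \<open>j\<close> and \<open>p ^ Suc a\<close> times
  \<open>x\<close> is a multiple of \<open>zmul j x\<close>; if \<open>p ^ Suc a\<close> does not
  divide \<open>j\<close>, this gcd divides \<open>p ^ a\<close>.\<close>

lemma prime_power_order:
  fixes x :: "'a::ab_group_add"
  assumes p: "prime (p::nat)" and x: "zmul (int (p ^ Suc a)) x = 0"
    and j: "\<not> int (p ^ Suc a) dvd j"
  shows "\<exists>s. zmul (int (p ^ a)) x = zmul s (zmul j x)"
proof -
  define g where "g = nat (gcd j (int (p ^ Suc a)))"
  have g: "int g = gcd j (int (p ^ Suc a))" by (simp add: g_def)
  have "int g dvd int (p ^ Suc a)" unfolding g by simp
  then have "g dvd p ^ Suc a" by (simp only: of_nat_dvd_iff)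
  then obtain i where i: "i \<le> Suc a" "g = p ^ i" using divides_primepow_nat [OF p] by blast
  have "int g dvd j" unfolding g by simp
  then have "i \<noteq> Suc a" using j i(2) by auto
  then have "g dvd p ^ a" using i by (auto intro: le_imp_power_dvd)
  then obtain c where c: "p ^ a = g * c" by (elim dvdE)
  obtain u v where uv: "u * j + v * int (p ^ Suc a) = int g" using bezout_int g by metis
  have "zmul (int g) x = zmul (u * j) x + zmul (v * int (p ^ Suc a)) x"
    unfolding uv [symmetric] by (rule zmul_add_left)
  also have "zmul (v * int (p ^ Suc a)) x = 0" using x by (simp flip: zm.scale_scale)
  finally have "zmul (int c) (zmul (int g) x) = zmul (int c) (zmul u (zmul j x))" by simp
  then show ?thesis by (intro exI [of _ "int c * u"]) (simp add: c mult_ac)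
qed

lemma prime_power_order_iff:
  fixes x :: "'a::ab_group_add"
  assumes "prime (p::nat)" "zmul (int (p ^ Suc a)) x = 0" "zmul (int (p ^ a)) x \<noteq> 0"
  shows "zmul j x = 0 \<longleftrightarrow> int (p ^ Suc a) dvd j"
proof
  show "int (p ^ Suc a) dvd j" if "zmul j x = 0"
    using prime_power_order [OF assms(1,2), of j] assms(3) that by auto
  show "zmul j x = 0" if "int (p ^ Suc a) dvd j"
    using that assms(2) by (auto elim!: dvdE simp: mult.commute [of "int p * int p ^ a"] simp flip: zm.scale_scale)
qed

lemma prime_order_multiple:
  fixes x :: "'a::ab_group_add"
  assumes "k \<noteq> 0" "zmul k x = 0" "x \<noteq> 0"
  obtains p :: nat and c where "prime p" "zmul c x \<noteq> 0" "zmul (int p) (zmul c x) = 0"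
proof -
  define M where "M = torsion_order x"
  note M = torsion_order [OF assms(1,2), folded M_def]
  have "M \<noteq> 1" using M(2) [of 1] assms(3) by auto
  then obtain p where p: "prime p" "p dvd M" using prime_factor_nat by blast
  then obtain c where c: "M = p * c" by (elim dvdE)
  have "\<not> M dvd c" using M(1) p(1) c prime_gt_1_nat [OF p(1)] by (auto dest!: dvd_imp_le)
  then have "zmul (int c) x \<noteq> 0" by (simp add: M(2))
  moreover have "zmul (int p) (zmul (int c) x) = 0" using M(2) [of "int M"] by (simp add: c)
  ultimately show ?thesis using that p(1) by blast
qed

lemma torsion_finite_span:
  fixes A :: "'a::ab_group_add set"
  assumes torsion: "\<And>x::'a. \<exists>k. k \<noteq> 0 \<and> zmul k x = 0" and A: "finite A"
  shows "finite (zm.span A)"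
  using A
proof (induction A)
  case (insert a A)
  obtain k where k: "k \<noteq> 0" "zmul k a = 0" using torsion by blast
  define n where "n = torsion_order a"
  note n = torsion_order [OF k, folded n_def]
  have "zm.span (insert a A) \<subseteq> (\<lambda>(j, t). zmul j a + t) ` ({0..<int n} \<times> zm.span A)"
  proof
    fix y assume "y \<in> zm.span (insert a A)"
    then obtain i where i: "y - zmul i a \<in> zm.span A" using zm.span_breakdown_eq by blast
    have "zmul (i - i mod int n) a = 0" by (simp add: n(2) minus_mod_eq_mult_div)
    then have "zmul i a = zmul (i mod int n) a" by (simp add: zmul_diff_left)
    then have "y = zmul (i mod int n) a + (y - zmul i a)" by simp
    then show "y \<in> (\<lambda>(j, t). zmul j a + t) ` ({0..<int n} \<times> zm.span A)"
      using i n(1) by (intro image_eqI [of _ _ "(i mod int n, y - zmul i a)"]) auto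
  qed
  then show ?case by (rule finite_subset) (simp add: insert.IH)
qed simp

text \<open>In a cyclic group of prime power order every nonzero subgroup contains the socle, so it is enough
  that the socle avoids \<open>F\<close>.\<close>

lemma large_order_trivial_intersection:
  fixes F :: "'a::ab_group_add set"
  assumes torsion: "\<And>x::'a. \<exists>k. k \<noteq> 0 \<and> zmul k x = 0" and F: "zm.subspace F"
    and x: "zmul (fact B) x \<noteq> 0" "\<And>j. zmul j (zmul (fact B) x) \<in> F \<Longrightarrow> zmul j (zmul (fact B) x) = 0"
  shows "\<exists>y. B < torsion_order y \<and> (\<forall>j. zmul j y \<in> F \<longrightarrow> zmul j y = 0)"
proof -
  define w where "w = zmul (fact B) x"
  have w: "w \<noteq> 0" "\<And>j. zmul j w \<in> F \<Longrightarrow> zmul j w = 0" using x by (simp_all add: w_def)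
  obtain k where k: "k \<noteq> 0" "zmul k w = 0" using torsion by blast
  obtain p c where p: "prime (p :: nat)" and c: "zmul c w \<noteq> 0" "zmul (int p) (zmul c w) = 0"
    using prime_order_multiple [OF k w(1)] by blast
  have "\<not> is_unit p" using p by auto
  \<comment> \<open>\<open>u\<close> is the part of \<open>fact B\<close> prime to \<open>p\<close>.
    Using it alone as a factor of \<open>y\<close> leaves \<open>p ^ a\<close> times
    \<open>y\<close> equal to \<open>zmul c w\<close>, of order \<open>p\<close>; hence
    \<open>y\<close> has order \<open>p ^ Suc a\<close>, and a power of \<open>p\<close> that does
    not divide \<open>fact B\<close> exceeds \<open>B\<close>.\<close>
  obtain u where u: "fact B = p ^ multiplicity p (fact B) * u" "\<not> p dvd u"
    by (rule multiplicity_decompose' [of "fact B" p]) (use \<open>\<not> is_unit p\<close> in auto)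
  define a where "a = multiplicity p (fact B :: nat)"
  define y where "y = zmul (int u) (zmul c x)"
  have fact_eq: "(fact B :: int) = int (p ^ a) * int u"
    using arg_cong [OF u(1), of int] by (simp add: a_def del: of_nat_power)
  have pa: "zmul (int (p ^ a)) y = zmul c w"
    by (simp add: y_def w_def fact_eq mult_ac)
  have pSa: "zmul (int (p ^ Suc a)) y = 0"
  proof -
    have "zmul (int (p ^ Suc a)) y = zmul (int p) (zmul (int (p ^ a)) y)" by simp
    then show ?thesis using c(2) unfolding pa by simp
  qed
  have order: "zmul j y = 0 \<longleftrightarrow> int (p ^ Suc a) dvd j" for j
    by (rule prime_power_order_iff [OF p pSa]) (unfold pa, rule c(1))
  have "B < p ^ Suc a"
  proof (rule ccontr)
    assume "\<not> B < p ^ Suc a"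
    then have "p ^ Suc a dvd fact B" using p by (intro dvd_fact) (auto simp: prime_gt_0_nat Suc_le_eq)
    then have "p ^ a * p dvd p ^ a * u" using u(1) by (simp add: a_def mult.commute)
    then show False using u(2) p by (simp add: prime_gt_0_nat)
  qed
  moreover have "torsion_order y = p ^ Suc a"
  proof -
    obtain k where "k \<noteq> 0" "zmul k y = 0" using torsion by blast
    from torsion_order(2) [OF this] have eq: "int (torsion_order y) dvd j \<longleftrightarrow> int (p ^ Suc a) dvd j" for j
      using order by simp
    have "int (torsion_order y) dvd int (p ^ Suc a)" by (simp only: eq dvd_refl)
    moreover have "int (p ^ Suc a) dvd int (torsion_order y)" by (simp only: eq [symmetric] dvd_refl)
    ultimately show ?thesis by (simp only: of_nat_dvd_iff dvd_antisym)
  qed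
  moreover have "zmul j y = 0" if "zmul j y \<in> F" for j
  proof (rule ccontr)
    assume "zmul j y \<noteq> 0"
    then obtain s where "zmul (int (p ^ a)) y = zmul s (zmul j y)"
      using prime_power_order [OF p pSa] order by blast
    then have "zmul c w \<in> F" using zm.subspace_scale [OF F that] pa by metis
    then show False using w(2) c(1) by blast
  qed
  ultimately show ?thesis by (intro exI [of _ y]) auto
qed

text \<open>Taking \<open>m = fact B\<close> yields elements of order above \<open>B\<close>. They
  are chosen successively, each against the span of its predecessors, which is finite because the
  group is torsion.\<close>

lemma unbounded_torsion_direct_sum:
  assumes torsion: "\<And>x::'a::ab_group_add. \<exists>k. k \<noteq> 0 \<and> zmul k x = 0"
    and ex: "\<And>(F::'a set) m::nat. finite F \<Longrightarrow> zm.subspace F \<Longrightarrow> m > 0 \<Longrightarrow>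
      \<exists>x. zmul (int m) x \<noteq> 0 \<and> (\<forall>j. zmul j (zmul (int m) x) \<in> F \<longrightarrow> zmul j (zmul (int m) x) = 0)"
  shows "\<exists>T :: 'a topology. metrizable_space T \<and> locally_quasi_convex T \<and> \<not> mackey T"
proof -
  have "\<exists>y::'a. B < torsion_order y \<and> (\<forall>j. zmul j y \<in> F \<longrightarrow> zmul j y = 0)"
    if F: "finite F" "zm.subspace F" for F B
  proof -
    obtain x where "zmul (int (fact B)) x \<noteq> 0"
      "\<forall>j. zmul j (zmul (int (fact B)) x) \<in> F \<longrightarrow> zmul j (zmul (int (fact B)) x) = 0"
      using ex [OF F, of "fact B"] by auto
    then show ?thesis by (intro large_order_trivial_intersection [OF torsion F(2), of B x]) auto
  qed
  then obtain f :: "'a set \<Rightarrow> nat \<Rightarrow> 'a" where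
    f: "\<And>F B. finite F \<Longrightarrow> zm.subspace F \<Longrightarrow> B < torsion_order (f F B)"
    "\<And>F B j. finite F \<Longrightarrow> zm.subspace F \<Longrightarrow> zmul j (f F B) \<in> F \<Longrightarrow> zmul j (f F B) = 0"
    by metis
  define A where "A = rec_nat {} (\<lambda>n A. insert (f (zm.span A) n) A)"
  define e where "e n = f (zm.span (A n)) n" for n
  have A_Suc: "A (Suc n) = insert (e n) (A n)" for n by (simp add: A_def e_def)
  have A: "A n = e ` {..<n}" for n
  proof (induction n)
    case 0
    then show ?case by (simp add: A_def)
  next
    case (Suc n)
    then show ?case by (simp add: A_Suc lessThan_Suc)
  qed
  have fin: "finite (zm.span (A n))" for n
    by (rule torsion_finite_span [OF torsion]) (simp add: A)
  show ?thesis
  proof (rule direct_sum_not_mackey)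
    show "zmul j (e n) = 0 \<longleftrightarrow> int (torsion_order (e n)) dvd j" for j n
      using torsion [of "e n"] torsion_order(2) by blast
    show "n < torsion_order (e n)" for n
      unfolding e_def by (rule f(1) [OF fin]) simp
    show "zmul j (e n) = 0" if "zmul j (e n) \<in> zm.span (e ` {..<n})" for j n
      using f(2) [OF fin [of n] zm.subspace_span, of j n, folded e_def, unfolded A] that .
  qed
qed

text \<open>By \<open>essential\<close>, nonzero cyclic subgroups of \<open>m G\<close> meet
  \<open>F\<close> nontrivially. The descending groups \<open>R n\<close> have a stable trace on the
  finite \<open>F\<close>, whose points therefore lie in every \<open>R n\<close>. Divisibility of
  \<open>R n0\<close> reduces to these points by induction on the order.\<close>

lemma unbounded_torsion_divisible:
  fixes F :: "'a::ab_group_add set"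
  assumes torsion: "\<And>x::'a. \<exists>k. k \<noteq> 0 \<and> zmul k x = 0"
    and unbounded: "\<And>m::nat. m > 0 \<Longrightarrow> \<exists>x::'a. zmul (int m) x \<noteq> 0"
    and F: "finite F" "zm.subspace F" and m: "m > 0"
    and essential: "\<And>x. zmul (int m) x \<noteq> 0 \<Longrightarrow>
      \<exists>j. zmul j (zmul (int m) x) \<in> F \<and> zmul j (zmul (int m) x) \<noteq> 0"
  obtains D :: "'a set" where "zm.subspace D" "D \<noteq> {0}"
    "\<And>l y. l > 0 \<Longrightarrow> y \<in> D \<Longrightarrow> \<exists>z\<in>D. y = zmul (int l) z"
proof -
  define R where "R n = range (zmul (int (m * fact n)) :: 'a \<Rightarrow> 'a)" for n :: nat
  have R: "zm.subspace (R n)" for n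
    unfolding zm.subspace_def
  proof (intro conjI ballI allI)
    have I: "zmul (int (m * fact n)) x \<in> R n" for x unfolding R_def by (rule rangeI)
    show "0 \<in> R n" using I [of 0] by simp
    fix y z :: 'a and c assume "y \<in> R n"
    then obtain y' where y': "y = zmul (int (m * fact n)) y'" unfolding R_def by blast
    have "zmul c y = zmul (int (m * fact n)) (zmul c y')" by (simp add: y' mult_ac)
    then show "zmul c y \<in> R n" using I by metis
    assume "z \<in> R n"
    then obtain z' where z': "z = zmul (int (m * fact n)) z'" unfolding R_def by blast
    have "y + z = zmul (int (m * fact n)) (y' + z')" by (simp add: y' z' zmul_add_right del: of_nat_mult)
    then show "y + z \<in> R n" using I by metis
  qed
  have R_anti: "R n \<subseteq> R k" if kn: "k \<le> n" for k n
  proof -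
    obtain c where c: "(fact n :: nat) = fact k * c" using fact_dvd [OF kn] by (auto elim!: dvdE)
    show ?thesis
    proof
      fix y assume "y \<in> R n"
      then obtain x where "y = zmul (int (m * fact n)) x" unfolding R_def by blast
      then have "y = zmul (int (m * fact k)) (zmul (int c) x)" by (simp add: c mult_ac flip: of_nat_mult)
      then show "y \<in> R k" unfolding R_def by blast
    qed
  qed
  obtain n0 where n0: "\<And>n. card (R n0 \<inter> F) \<le> card (R n \<inter> F)"
    using ex_has_least_nat [of "\<lambda>_. True" 0 "\<lambda>n. card (R n \<inter> F)"] by auto
  have stable: "R n \<inter> F = R n0 \<inter> F" if "n \<ge> n0" for n
    using R_anti [OF that] n0 [of n] F(1) by (intro card_seteq) auto
  have stable': "y \<in> R n" if "y \<in> R n0" "y \<in> F" for y n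
    using that stable [of n] R_anti [of n n0] by (cases "n \<ge> n0") auto
  have div: "\<exists>z\<in>R n0. y = zmul (int l) z" if l: "l > 0" and y: "y \<in> R n0" for l y
    using y
  proof (induction "torsion_order y" arbitrary: y rule: less_induct)
    case less
    show ?case
    proof (cases "y = 0")
      case True
      then show ?thesis using zm.subspace_0 [OF R] by (intro bexI [of _ 0]) auto
    next
      case False
      define M where "M = torsion_order y"
      obtain k where "k \<noteq> 0" "zmul k y = 0" using torsion by blast
      note M = torsion_order [OF this, folded M_def]
      obtain x where x: "y = zmul (int m) (zmul (fact n0) x)"
        using less(2) unfolding R_def by (auto simp: of_nat_fact)
      then obtain j where j: "zmul j y \<in> F" "zmul j y \<noteq> 0" using essential False by metis
      define g where "g = nat (gcd j (int M))"
      have g: "int g = gcd j (int M)" by (simp add: g_def)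
      have g0: "g > 0" using M(1) g by (metis gcd_pos_int of_nat_0_less_iff of_nat_0 less_irrefl)
      obtain s t where st: "s * j + t * int M = int g" using bezout_int g by metis
      have "zmul (int g) y = zmul s (zmul j y) + zmul t (zmul (int M) y)"
        unfolding st [symmetric] by (simp add: zmul_add_left)
      also have "zmul (int M) y = 0" by (simp add: M(2))
      finally have "zmul (int g) y \<in> F" using zm.subspace_scale [OF F(2) j(1)] by simp
      moreover have "zmul (int g) y \<in> R n0" by (rule zm.subspace_scale [OF R less(2)])
      \<comment> \<open>The factorial of this index is divisible by \<open>g * l * fact n0\<close>;
        so \<open>zmul g y\<close> is \<open>g * l\<close> times an element \<open>z\<close> that
        still lies in \<open>R n0\<close>.\<close>
      ultimately have "zmul (int g) y \<in> R (g * l * fact n0)" using stable' by blast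
      then obtain v where v: "zmul (int g) y = zmul (int (m * fact (g * l * fact n0))) v"
        unfolding R_def by blast
      have "g * l * fact n0 dvd (fact (g * l * fact n0) :: nat)"
        using g0 l by (intro dvd_fact) (auto simp: Suc_le_eq)
      then obtain c where c: "(fact (g * l * fact n0) :: nat) = g * l * fact n0 * c" by (elim dvdE)
      define z where "z = zmul (int (m * fact n0)) (zmul (int c) v)"
      have z: "z \<in> R n0" unfolding z_def R_def by (rule rangeI)
      \<comment> \<open>The difference is killed by \<open>g\<close>, a proper divisor of the order
        of \<open>y\<close>, so the induction hypothesis divides it by \<open>l\<close>.\<close>
      define y' where "y' = y - zmul (int l) z"
      have y': "y' \<in> R n0" unfolding y'_def by (intro zm.subspace_diff zm.subspace_scale R less(2) z)
      have "zmul (int g) (zmul (int l) z) = zmul (int (m * fact (g * l * fact n0))) v"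
        unfolding z_def c by (simp add: mult_ac)
      then have gy': "zmul (int g) y' = 0" using v by (simp add: y'_def zm.scale_right_diff_distrib)
      have "torsion_order y' \<le> g"
        using torsion_order(2) [of "int g" y' "int g"] gy' g0 by (auto dest: dvd_imp_le)
      moreover have "g < M"
      proof -
        have "int g dvd int M" "int g dvd j" unfolding g by simp_all
        then have "g dvd M" "g \<noteq> M" using j(2) M(2) by auto
        then show ?thesis using M(1) by (simp add: dvd_imp_le le_neq_implies_less)
      qed
      ultimately obtain z' where z': "z' \<in> R n0" "y' = zmul (int l) z'"
        using less(1) [OF _ y'] unfolding M_def by auto
      then have "y = zmul (int l) (z' + z)" by (simp add: y'_def zmul_add_right diff_eq_eq)
      then show ?thesis using zm.subspace_add [OF R z'(1) z] by blast
    qed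
  qed
  have "m * fact n0 > 0" using m by simp
  then obtain x where x: "zmul (int (m * fact n0)) x \<noteq> (0 :: 'a)" using unbounded by blast
  have "zmul (int (m * fact n0)) x \<in> R n0" unfolding R_def by (rule rangeI)
  then have "R n0 \<noteq> {0}" using x by blast
  then show ?thesis using that [of "R n0"] R div by blast
qed

text \<open>Starting from an element of prime order, the passage from \<open>e k\<close> to
  \<open>e (Suc k)\<close> divides by \<open>p ^ (2 * Suc k + 1)\<close>. Up to \<open>e k\<close>
  the exponents add up to \<open>Suc k ^ 2 - 1\<close>, and the prime order of \<open>e 0\<close>
  supplies the missing 1.\<close>

lemma divisible_torsion_not_mackey:
  fixes D :: "'a::ab_group_add set"
  assumes torsion: "\<And>x::'a. \<exists>k. k \<noteq> 0 \<and> zmul k x = 0"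
    and D: "zm.subspace D" "D \<noteq> {0}"
    and div: "\<And>l y. l > 0 \<Longrightarrow> y \<in> D \<Longrightarrow> \<exists>z\<in>D. y = zmul (int l) z"
  shows "\<exists>T :: 'a topology. metrizable_space T \<and> locally_quasi_convex T \<and> \<not> mackey T"
proof -
  obtain y where y: "y \<in> D" "y \<noteq> 0" using D zm.subspace_0 by blast
  obtain k where k: "k \<noteq> 0" "zmul k y = 0" using torsion by blast
  obtain p c where p: "prime (p :: nat)" and c: "zmul c y \<noteq> 0" "zmul (int p) (zmul c y) = 0"
    using prime_order_multiple [OF k y(2)] by blast
  obtain f where f: "\<And>l y. l > 0 \<Longrightarrow> y \<in> D \<Longrightarrow> f l y \<in> D"
    "\<And>l y. l > 0 \<Longrightarrow> y \<in> D \<Longrightarrow> zmul (int l) (f l y) = y" using div by metis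
  define e where "e = rec_nat (zmul c y) (\<lambda>k. f (p ^ (2 * Suc k + 1)))"
  have e_0: "e 0 = zmul c y" and e_Suc: "e (Suc k) = f (p ^ (2 * Suc k + 1)) (e k)" for k
    by (simp_all add: e_def)
  have pos: "p ^ n > 0" for n using p by (simp add: prime_gt_0_nat)
  have e_D: "e k \<in> D" for k
    by (induction k) (simp_all only: e_0 e_Suc zm.subspace_scale [OF D(1) y(1)] f(1) [OF pos])
  have tower: "zmul (int (p ^ (2 * Suc k + 1))) (e (Suc k)) = e k" for k
    unfolding e_Suc by (rule f(2) [OF pos e_D])
  have sq: "Suc (Suc k) ^ 2 - 1 = (Suc k ^ 2 - 1) + (2 * Suc k + 1)" for k :: nat
    by (simp add: power2_eq_square)
  have last: "zmul (int (p ^ (Suc k ^ 2 - 1))) (e k) = zmul c y" for k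
  proof (induction k)
    case (Suc k)
    have "zmul (int (p ^ (Suc (Suc k) ^ 2 - 1))) (e (Suc k))
        = zmul (int (p ^ (Suc k ^ 2 - 1))) (zmul (int (p ^ (2 * Suc k + 1))) (e (Suc k)))"
      unfolding sq power_add by simp
    then show ?case unfolding tower Suc .
  qed (simp add: e_0)
  have Suc_sq: "Suc (Suc k ^ 2 - 1) = Suc k ^ 2" for k :: nat by simp
  have order: "zmul j (e k) = 0 \<longleftrightarrow> int (p ^ (Suc k ^ 2)) dvd j" for j k
  proof -
    have "zmul (int (p ^ Suc (Suc k ^ 2 - 1))) (e k) = zmul (int p) (zmul (int (p ^ (Suc k ^ 2 - 1))) (e k))"
      by (simp only: power_Suc of_nat_mult zm.scale_scale)
    then have "zmul (int (p ^ Suc (Suc k ^ 2 - 1))) (e k) = 0" unfolding last c(2) .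
    from prime_power_order_iff [OF p this] show ?thesis unfolding last Suc_sq using c(1) by blast
  qed
  show ?thesis by (rule quasicyclic_not_mackey [OF prime_ge_2_nat [OF p] order tower])
qed

lemma unbounded_not_mackey:
  assumes unbounded: "\<And>m::nat. m > 0 \<Longrightarrow> \<exists>x::'a::ab_group_add. zmul (int m) x \<noteq> 0"
  shows "\<exists>T :: 'a topology. metrizable_space T \<and> locally_quasi_convex T \<and> \<not> mackey T"
proof (cases "\<forall>x::'a. \<exists>k. k \<noteq> 0 \<and> zmul k x = 0")
  case False
  then show ?thesis using infinite_order_not_mackey by blast
next
  case True
  then have torsion: "\<exists>k. k \<noteq> 0 \<and> zmul k x = 0" for x :: 'a by blast
  show ?thesis
  \<comment> \<open>The negation of this condition is the hypothesis \<open>essential\<close> of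
    \<open>unbounded_torsion_divisible\<close>.\<close>
  proof (cases "\<forall>(F::'a set) m::nat. finite F \<longrightarrow> zm.subspace F \<longrightarrow> m > 0 \<longrightarrow>
      (\<exists>x. zmul (int m) x \<noteq> 0 \<and> (\<forall>j. zmul j (zmul (int m) x) \<in> F \<longrightarrow> zmul j (zmul (int m) x) = 0))")
    case True
    then show ?thesis by (intro unbounded_torsion_direct_sum [OF torsion]) blast
  next
    case False
    then obtain F :: "'a set" and m :: nat where Fm: "finite F" "zm.subspace F" "m > 0"
      "\<And>x. zmul (int m) x \<noteq> 0 \<Longrightarrow> \<exists>j. zmul j (zmul (int m) x) \<in> F \<and> zmul j (zmul (int m) x) \<noteq> 0"
      by blast
    show ?thesis
    proof (rule unbounded_torsion_divisible [OF torsion unbounded Fm])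
      fix D :: "'a set"
      assume "zm.subspace D" "D \<noteq> {0}"
        "\<And>l y. l > 0 \<Longrightarrow> y \<in> D \<Longrightarrow> \<exists>z\<in>D. y = zmul (int l) z"
      then show ?thesis by (rule divisible_torsion_not_mackey [OF torsion])
    qed
  qed
qed

theorem theoremA:
  "(\<forall>T :: 'a::ab_group_add topology. metrizable_space T \<and> locally_quasi_convex T \<longrightarrow> mackey T)
     \<longleftrightarrow> bounded_group TYPE('a)"
proof -
  have "bounded_group TYPE('a) \<longleftrightarrow> (\<exists>m::nat. m > 0 \<and> (\<forall>x::'a. zmul (int m) x = 0))"
    by (auto simp: bounded_group_def zmul_of_nat)
  then show ?thesis
    using bounded_metrizable_mackey unbounded_not_mackey by blast
qed

end
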